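(* Let $(T,r)$ be a locally compact $\mathbb{R}$-tree and $\nu$ a Radon measure on $(T,\mathcal{B}(T))$ (finite on compact sets and positive on every open ball). Then the Dirichlet form $(\mathcal{E},\mathcal{D}(\mathcal{E}))$ is regular, i.e., (i) $\mathcal{D}(\mathcal{E})\cap\mathcal{C}_0(T)$ is dense in $\mathcal{D}(\mathcal{E})$ with respect to the topology generated by $\mathcal{E}_1$; (ii) $\mathcal{D}(\mathcal{E})\cap\mathcal{C}_0(T)$ is dense in $\mathcal{C}_0(T)$ with respect to the uniform topology.
   Context: An $\mathbb{R}$-tree is a metric space $(T,r)$ such that (1) for all $u,v\in T$ there is a unique isometric embedding $\phi_{u,v}:[0,r(u,v)]\to T$ with $\phi_{u,v}(0)=u$, $\phi_{u,v}(r(u,v))=v$; (2) every injective continuous $\kappa:[0,1]\to T$ satisfies $\kappa([0,1])=\phi_{\kappa(0),\kappa(1)}([0,r(\kappa(0),\kappa(1))])$. Write $[a,b]=\phi_{a,b}([0,r(a,b)])$ and $]a,b[=\phi_{a,b}(]0,r(a,b)[)$. For $a,b,x\in T$, $c(a,b,x)$ is the unique point with $[a,x]\cap[a,b]=[a,c(a,b,x)]$. Length measure: locally compact $\mathbb{R}$-trees are separable; $\lambda=\lambda^{(T,r)}$ is the unique $\sigma$-finite Borel measure on $T$ with $\lambda(]a,b[)=r(a,b)$ for all $a,b\in T$ and $\lambda(T\setminus T^o)=0$, where $T^o=\bigcup_{a,b\in T}]a,b[$. Gradient: fix a root $\rho\in T$, put $x\wedge y:=c(\rho,x,y)$ and $\int_x^y\lambda(\mathrm{d}z)\,g(z):=-\int_{[x\wedge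 y,x]}g\,\mathrm{d}\lambda+\int_{[x\wedge y,y]}g\,\mathrm{d}\lambda$. A continuous $f:T\to\mathbb{R}$ is locally absolutely continuous ($f\in\mathcal{A}$) if for every $\varepsilon>0$ and every $S\subseteq T$ with $\lambda(S)<\infty$ there is $\delta>0$ such that for disjoint arcs $[x_1,y_1],\dots,[x_n,y_n]\subseteq S$ with $\sum_i r(x_i,y_i)<\delta$ one has $\sum_i|f(x_i)-f(y_i)|<\varepsilon$. For $f\in\mathcal{A}$, $\nabla f$ is the $\lambda$-a.e. unique function with $f(y)-f(x)=\int_x^y\lambda(\mathrm{d}z)\,\nabla f(z)$ for all $x,y\in T$. Form: $\mathcal{C}_0(T)$ is the set of continuous real functions on $T$ with compact support; $\mathcal{C}_\infty(T)$ is the set of continuous $f:T\to\mathbb{R}$ such that for every $\varepsilon>0$ there is a compact $K$ with $|f|\le\varepsilon$ on $T\setminus K$. $\mathcal{F}:=\{f\in\mathcal{A}:\nabla f\in L^2(\lambda)\}$, $\mathcal{D}(\mathcal{E}):=\mathcal{F}\cap L^2(\nu)\cap\mathcal{C}_\infty(T)$, $\mathcal{E}(f,g):=\frac12\int\lambda(\mathrm{d}z)\,\nabla f(z)\nabla g(z)$ (independent of the choice of $\rho$), and $\mathcal{E}_1(f,g):=\mathcal{E}(f,g)+\int fg\,\mathrm{d}\nu$. *)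

theory Defs
  imports "HOL-Analysis.Analysis"
begin

text \<open>The tree \<open>T\<close> is the carrier of a type of class \<^class>\<open>metric_space\<close>, with \<open>r\<close> its
  distance \<^const>\<open>dist\<close>.\<close>

text \<open>Paths are functions on all of \<^typ>\<open>real\<close>; extensionality makes a path on
  \<open>{0..dist u v}\<close> a single function, so that uniqueness can be expressed by \<open>\<exists>!\<close>.\<close>

definition geodesic :: "'a::metric_space \<Rightarrow> 'a \<Rightarrow> (real \<Rightarrow> 'a) \<Rightarrow> bool" where
  "geodesic u v \<phi> \<longleftrightarrow>
     \<phi> \<in> extensional {0..dist u v} \<and>
     (\<forall>s\<in>{0..dist u v}. \<forall>t\<in>{0..dist u v}. dist (\<phi> s) (\<phi> t) = dist s t) \<and>
     \<phi> 0 = u \<and> \<phi> (dist u v) = v"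

definition geo :: "'a::metric_space \<Rightarrow> 'a \<Rightarrow> real \<Rightarrow> 'a" where
  "geo u v = (THE \<phi>. geodesic u v \<phi>)"

definition seg :: "'a::metric_space \<Rightarrow> 'a \<Rightarrow> 'a set" where
  "seg a b = geo a b ` {0..dist a b}"

definition open_seg :: "'a::metric_space \<Rightarrow> 'a \<Rightarrow> 'a set" where
  "open_seg a b = geo a b ` {0<..<dist a b}"

definition R_tree :: "'a::metric_space itself \<Rightarrow> bool" where
  "R_tree (_ :: 'a itself) \<longleftrightarrow>
     (\<forall>u v :: 'a. \<exists>!\<phi>. geodesic u v \<phi>) \<and>
     (\<forall>\<kappa> :: real \<Rightarrow> 'a. arc \<kappa> \<longrightarrow> path_image \<kappa> = seg (pathstart \<kappa>) (pathfinish \<kappa>))"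

definition branch_pt :: "'a::metric_space \<Rightarrow> 'a \<Rightarrow> 'a \<Rightarrow> 'a" where
  "branch_pt a b x = (THE c. seg a x \<inter> seg a b = seg a c)"

definition skeleton :: "'a::metric_space set" where
  "skeleton = (\<Union>a. \<Union>b. open_seg a b)"

definition is_length_measure :: "'a::metric_space measure \<Rightarrow> bool" where
  "is_length_measure M \<longleftrightarrow>
     sets M = sets borel \<and> sigma_finite_measure M \<and>
     (\<forall>a b. emeasure M (open_seg a b) = ennreal (dist a b)) \<and>
     UNIV - skeleton \<in> null_sets M"

definition length_measure :: "'a::metric_space measure" where
  "length_measure = (THE M. is_length_measure M)"

text \<open>\<open>meet \<rho> x y\<close> is \<open>x \<and> y\<close> for the root \<open>\<rho>\<close>.\<close>

definition meet :: "'a::metric_space \<Rightarrow> 'a \<Rightarrow> 'a \<Rightarrow> 'a" where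
  "meet \<rho> x y = branch_pt \<rho> x y"

definition tree_integral :: "'a::metric_space \<Rightarrow> ('a \<Rightarrow> real) \<Rightarrow> 'a \<Rightarrow> 'a \<Rightarrow> real" where
  "tree_integral \<rho> g x y =
     - (LINT z:seg (meet \<rho> x y) x|length_measure. g z)
     + (LINT z:seg (meet \<rho> x y) y|length_measure. g z)"

text \<open>The sets \<open>S\<close> of finite length are required to be Borel, because \<^const>\<open>emeasure\<close> is
  \<open>0\<close> on non-measurable sets.\<close>

definition loc_abs_cont :: "('a::metric_space \<Rightarrow> real) set" where
  "loc_abs_cont = {f. continuous_on UNIV f \<and>
     (\<forall>\<epsilon>>0. \<forall>S\<in>sets borel. emeasure length_measure S < \<infinity> \<longrightarrow>
       (\<exists>\<delta>>0. \<forall>(n::nat) x y.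
          (\<forall>i<n. seg (x i) (y i) \<subseteq> S) \<and>
          disjoint_family_on (\<lambda>i. seg (x i) (y i)) {..<n} \<and>
          (\<Sum>i<n. dist (x i) (y i)) < \<delta> \<longrightarrow>
          (\<Sum>i<n. \<bar>f (x i) - f (y i)\<bar>) < \<epsilon>))}"

text \<open>Integrability on arcs is demanded so that the Bochner integrals in
  \<^const>\<open>tree_integral\<close> do not take their default value \<open>0\<close>.\<close>

definition has_gradient ::
    "'a::metric_space \<Rightarrow> ('a \<Rightarrow> real) \<Rightarrow> ('a \<Rightarrow> real) \<Rightarrow> bool" where
  "has_gradient \<rho> f g \<longleftrightarrow>
     g \<in> borel_measurable borel \<and>
     (\<forall>x y. set_integrable length_measure (seg x y) g) \<and>
     (\<forall>x y. f y - f x = tree_integral \<rho> g x y)"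

text \<open>A version of the gradient, which is determined up to a null set.\<close>

definition grad :: "'a::metric_space \<Rightarrow> ('a \<Rightarrow> real) \<Rightarrow> 'a \<Rightarrow> real" where
  "grad \<rho> f = (SOME g. has_gradient \<rho> f g)"

definition L2 :: "'a measure \<Rightarrow> ('a \<Rightarrow> real) set" where
  "L2 M = {f \<in> borel_measurable M. integrable M (\<lambda>x. (f x)\<^sup>2)}"

definition C_0 :: "('a::metric_space \<Rightarrow> real) set" where
  "C_0 = {f. continuous_on UNIV f \<and> compact (closure {x. f x \<noteq> 0})}"

definition C_inf :: "('a::metric_space \<Rightarrow> real) set" where
  "C_inf = {f. continuous_on UNIV f \<and>
     (\<forall>\<epsilon>>0. \<exists>K. compact K \<and> (\<forall>x. x \<notin> K \<longrightarrow> \<bar>f x\<bar> \<le> \<epsilon>))}"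

text \<open>The conjunct \<open>has_gradient \<rho> f (grad \<rho> f)\<close> says that \<open>f\<close> has a gradient, so that
  \<open>grad \<rho> f\<close> is not an arbitrary choice.\<close>

definition form_space :: "'a::metric_space \<Rightarrow> ('a \<Rightarrow> real) set" where
  "form_space \<rho> =
     {f \<in> loc_abs_cont. has_gradient \<rho> f (grad \<rho> f) \<and> grad \<rho> f \<in> L2 length_measure}"

definition form_domain :: "'a::metric_space \<Rightarrow> 'a measure \<Rightarrow> ('a \<Rightarrow> real) set" where
  "form_domain \<rho> \<nu> = form_space \<rho> \<inter> L2 \<nu> \<inter> C_inf"

definition form :: "'a::metric_space \<Rightarrow> ('a \<Rightarrow> real) \<Rightarrow> ('a \<Rightarrow> real) \<Rightarrow> real" where
  "form \<rho> f g = 1 / 2 * (\<integral>z. grad \<rho> f z * grad \<rho> g z \<partial>length_measure)"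

definition form1 ::
    "'a::metric_space \<Rightarrow> 'a measure \<Rightarrow> ('a \<Rightarrow> real) \<Rightarrow> ('a \<Rightarrow> real) \<Rightarrow> real" where
  "form1 \<rho> \<nu> f g = form \<rho> f g + (\<integral>x. f x * g x \<partial>\<nu>)"

definition radon_measure :: "'a::metric_space measure \<Rightarrow> bool" where
  "radon_measure \<nu> \<longleftrightarrow>
     sets \<nu> = sets borel \<and>
     (\<forall>K. compact K \<longrightarrow> emeasure \<nu> K < \<infinity>) \<and>
     (\<forall>x. \<forall>e>0. emeasure \<nu> (ball x e) > 0)"

definition dense_for :: "('b \<Rightarrow> 'b \<Rightarrow> real) \<Rightarrow> 'b set \<Rightarrow> 'b set \<Rightarrow> bool" where
  "dense_for d A B \<longleftrightarrow> A \<subseteq> B \<and> (\<forall>f\<in>B. \<forall>\<epsilon>>0. \<exists>g\<in>A. d f g < \<epsilon>)"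

definition form1_dist ::
    "'a::metric_space \<Rightarrow> 'a measure \<Rightarrow> ('a \<Rightarrow> real) \<Rightarrow> ('a \<Rightarrow> real) \<Rightarrow> real" where
  "form1_dist \<rho> \<nu> f g = sqrt (form1 \<rho> \<nu> (\<lambda>x. f x - g x) (\<lambda>x. f x - g x))"

text \<open>Used only on \<^const>\<open>C_0\<close>, where the supremum is over a bounded set.\<close>

definition sup_dist :: "('a \<Rightarrow> real) \<Rightarrow> ('a \<Rightarrow> real) \<Rightarrow> real" where
  "sup_dist f g = (SUP x. \<bar>f x - g x\<bar>)"

end

theory Submission
  imports Defs
begin

text \<open>All arcs are referred to the root: \<open>f\<close> has gradient \<open>g\<close> iff \<open>f x - f \<rho>\<close> is the integral of
  \<open>g\<close> over \<open>[\<rho>, x]\<close> for every \<open>x\<close>, and this arc carries a copy of Lebesgue measure on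
  \<open>[0, r(\<rho>, x)]\<close>. A countable dense set of points \<open>x\<^sub>n\<close> then gives existence and uniqueness of the
  length measure, and reduces the calculus of gradients to the line.

  For (i), truncate \<open>f\<close> smoothly near the value \<open>0\<close>: the error \<open>\<psi>\<^sub>n(f)\<close> has gradient \<open>\<psi>\<^sub>n'(f) \<nabla>f\<close> with
  \<open>0 \<le> \<psi>\<^sub>n' \<le> 1\<close> and \<open>\<psi>\<^sub>n'\<close> tending to the indicator of \<open>0\<close>, while \<open>\<nabla>f = 0\<close> almost everywhere on
  \<open>f = 0\<close>; dominated convergence applies. For (ii), the bounded functions in \<open>\<F>\<close> form an algebra
  that contains the Gromov products \<open>r(\<rho>, y \<and> \<cdot>)\<close>, which separate points. Products of
  functions \<open>s - r(x, c(x, y, \<cdot>))\<close> over the finitely many branches leaving a small ball give bumps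
  of compact support. With a finite sum \<open>B\<close> of bumps that is positive on the support of \<open>f\<close>, write
  \<open>f = h B\<close> and apply Stone--Weierstrass to \<open>h\<close> on the support of \<open>B\<close>.\<close>

section \<open>Geometry of real trees\<close>

text \<open>\<open>grad\<close> is an arbitrary choice among gradients, so the form can be evaluated
  only through their almost everywhere uniqueness. Functions are then placed in the form space by
  exhibiting one square integrable gradient; local absolute continuity follows from it by Young's
  inequality.

  In (i) the values of \<open>f\<close> are truncated, not its domain. Since \<open>f\<close>
  vanishes at infinity, this already produces compact support, and no energy of a spatial cutoff has
  to be estimated. The truncation is smooth because the chain rule is proved for continuously
  differentiable functions only.

  In (ii) Stone--Weierstrass controls an approximant on a compact set only. The factor
  \<open>B\<close> removes what happens elsewhere: an approximant \<open>a\<close> of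
  \<open>h\<close> becomes \<open>a B\<close>, which vanishes wherever \<open>B\<close> does and
  keeps its gradient square integrable because bounded functions of the form space can be
  multiplied.\<close>

locale real_tree =
  fixes T :: "'a::metric_space itself"
  assumes R_tree: "R_tree TYPE('a)"
begin

lemma geodesic_geo: "geodesic a b (geo a (b::'a))"
  using R_tree unfolding R_tree_def geo_def by (metis theI')

lemma geo_eqI: "geodesic a b \<phi> \<Longrightarrow> geo a (b::'a) = \<phi>"
  using R_tree geodesic_geo unfolding R_tree_def by metis

lemma geo_0 [simp]: "geo a (b::'a) 0 = a" and geo_dist [simp]: "geo a b (dist a b) = b"
  using geodesic_geo[of a b] by (auto simp: geodesic_def)

lemma dist_geo_geo:
  "\<lbrakk>s \<in> {0..dist a b}; t \<in> {0..dist a b}\<rbrakk> \<Longrightarrow> dist (geo a (b::'a) s) (geo a b t) = \<bar>s - t\<bar>"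
  using geodesic_geo[of a b] by (auto simp: geodesic_def dist_real_def)

lemma dist_geo_left: "t \<in> {0..dist a b} \<Longrightarrow> dist a (geo a (b::'a) t) = t"
  using dist_geo_geo[of 0 a b t] by auto

lemma dist_geo_right: "t \<in> {0..dist a b} \<Longrightarrow> dist (geo a (b::'a) t) b = dist a b - t"
  using dist_geo_geo[of t a b "dist a b"] by auto

text \<open>Lengths add up exactly, so concatenating the geodesics through \<open>z\<close> creates
  no detour. Uniqueness of geodesics then forces \<open>z\<close> onto the arc from \<open>a\<close>
  to \<open>b\<close>.\<close>

lemma geodesic_join:
  fixes a b z :: 'a
  assumes "dist a z + dist z b = dist a b"
  defines "\<phi> \<equiv> restrict (\<lambda>t. if t \<le> dist a z then geo a z t else geo z b (t - dist a z)) {0..dist a b}"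
  shows "geodesic a b \<phi>"
proof -
  have pos: "0 \<le> dist a z" "0 \<le> dist z b"
    by (rule zero_le_dist)+
  have fa: "dist a (\<phi> t) = t" if "t \<in> {0..dist a b}" "t \<le> dist a z" for t
    using that dist_geo_left[of t a z] by (auto simp: \<phi>_def)
  have fz: "dist z (\<phi> t) = t - dist a z \<and> dist (\<phi> t) b = dist a b - t"
    if "t \<in> {0..dist a b}" "\<not> t \<le> dist a z" for t
    using that assms(1) dist_geo_left[of "t - dist a z" z b] dist_geo_right[of "t - dist a z" z b]
    by (auto simp: \<phi>_def)
  have az: "dist (\<phi> t) z = dist a z - t" if "t \<in> {0..dist a b}" "t \<le> dist a z" for t
    using that dist_geo_right[of t a z] by (auto simp: \<phi>_def)
  have le: "dist (\<phi> s) (\<phi> t) = t - s"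
    if "s \<in> {0..dist a b}" "t \<in> {0..dist a b}" "s \<le> t" for s t
  proof -
    consider "t \<le> dist a z" | "s \<le> dist a z" "\<not> t \<le> dist a z" | "\<not> s \<le> dist a z"
      by linarith
    then show ?thesis
    proof cases
      case 1
      then show ?thesis using that dist_geo_geo[of s a z t] by (auto simp: \<phi>_def)
    next
      case 2
      then have "dist (\<phi> s) (\<phi> t) \<le> t - s"
        using dist_triangle[of "\<phi> s" "\<phi> t" z] az[of s] fz[of t] that by (auto simp: dist_commute)
      \<comment> \<open>A shortcut between the two halves would give a way from \<open>a\<close> to
        \<open>b\<close> shorter than \<open>dist a b\<close>.\<close>
      moreover have "dist a b \<le> dist a (\<phi> s) + dist (\<phi> s) (\<phi> t) + dist (\<phi> t) b"
        using dist_triangle[of a b "\<phi> t"] dist_triangle[of a "\<phi> t" "\<phi> s"] by linarith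
      ultimately show ?thesis using fa[of s] fz[of t] that 2 by auto
    next
      case 3
      then show ?thesis
        using that assms(1) dist_geo_geo[of "s - dist a z" z b "t - dist a z"] by (auto simp: \<phi>_def)
    qed
  qed
  have "dist (\<phi> s) (\<phi> t) = dist s t" if "s \<in> {0..dist a b}" "t \<in> {0..dist a b}" for s t
  proof (cases "s \<le> t")
    case True then show ?thesis using le[OF that] by (simp add: dist_real_def)
  next
    case False then show ?thesis using le[OF that(2,1)] by (simp add: dist_real_def dist_commute)
  qed
  moreover have "\<phi> 0 = a"
    by (simp add: \<phi>_def)
  \<comment> \<open>At the endpoint the first branch of \<open>\<phi>\<close> is taken only when
    \<open>z = b\<close>.\<close>
  moreover have "\<phi> (dist a b) = b"
  proof (cases "dist a b \<le> dist a z")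
    case True
    then have "dist z b = 0" using assms(1) pos by linarith
    then have "z = b" by simp
    then show ?thesis by (simp add: \<phi>_def)
  next
    case False
    have "dist a b - dist a z = dist z b" using assms(1) by simp
    then show ?thesis using False by (simp add: \<phi>_def)
  qed
  moreover have "\<phi> \<in> extensional {0..dist a b}"
    by (simp add: \<phi>_def)
  ultimately show ?thesis unfolding geodesic_def by blast
qed

text \<open>This turns questions about arcs into linear arithmetic with distances. The direction
  from right to left is where uniqueness of geodesics enters.\<close>

lemma seg_iff: "z \<in> seg a (b::'a) \<longleftrightarrow> dist a z + dist z b = dist a b"
proof
  assume "z \<in> seg a b"
  then show "dist a z + dist z b = dist a b"
    by (auto simp: seg_def dist_geo_left dist_geo_right)
next
  assume *: "dist a z + dist z b = dist a b"
  have le: "dist a z \<in> {0..dist a b}"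
    using * zero_le_dist[of a z] zero_le_dist[of z b] unfolding atLeastAtMost_iff by linarith
  then have "geo a b (dist a z) = z"
    using geo_eqI[OF geodesic_join[OF *]] by simp
  moreover note le
  ultimately show "z \<in> seg a b"
    unfolding seg_def by (metis imageI)
qed

lemma geo_dist_seg: "z \<in> seg a b \<Longrightarrow> geo a (b::'a) (dist a z) = z"
  by (auto simp: seg_def dist_geo_left)

lemma seg_dist_bounds: "z \<in> seg a (b::'a) \<Longrightarrow> dist a z \<in> {0..dist a b}"
  by (auto simp: seg_def dist_geo_left)

lemma geo_in_seg: "t \<in> {0..dist a b} \<Longrightarrow> geo a (b::'a) t \<in> seg a b"
  by (auto simp: seg_def)

lemma seg_commute: "seg a b = seg b (a::'a)"
  by (auto simp: seg_iff dist_commute add.commute)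

lemma seg_ends [simp]: "a \<in> seg a (b::'a)" "b \<in> seg a b" and seg_refl [simp]: "seg a a = {a}"
  by (auto simp: seg_iff dist_commute)

lemma seg_sub:
  assumes "z \<in> seg a (b::'a)" shows "seg a z \<subseteq> seg a b"
proof
  fix w assume "w \<in> seg a z"
  then show "w \<in> seg a b"
    using assms dist_triangle[of w b z] dist_triangle[of a b w] unfolding seg_iff by linarith
qed

lemma seg_sub2: "z \<in> seg a (b::'a) \<Longrightarrow> seg z b \<subseteq> seg a b"
  using seg_sub[of z b a] by (simp add: seg_commute)

lemma seg_order:
  assumes "z \<in> seg a b" "w \<in> seg a (b::'a)"
  shows "dist z w = \<bar>dist a z - dist a w\<bar>"
  using dist_geo_geo[of "dist a z" a b "dist a w"] assms
  by (simp add: geo_dist_seg seg_dist_bounds del: atLeastAtMost_iff)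

lemma seg_left_iff:
  assumes "z \<in> seg a (b::'a)"
  shows "w \<in> seg a z \<longleftrightarrow> w \<in> seg a b \<and> dist a w \<le> dist a z"
  using assms seg_sub[OF assms] seg_order[OF _ assms, of w] seg_dist_bounds[of w a z]
  by (auto simp: seg_iff)

lemma seg_right_iff:
  assumes "z \<in> seg a (b::'a)"
  shows "w \<in> seg z b \<longleftrightarrow> w \<in> seg a b \<and> dist a z \<le> dist a w"
proof
  assume w: "w \<in> seg z b"
  then have "w \<in> seg a b" using seg_sub2[OF assms] by blast
  then show "w \<in> seg a b \<and> dist a z \<le> dist a w"
    using assms w zero_le_dist[of z w] unfolding seg_iff by linarith
next
  assume "w \<in> seg a b \<and> dist a z \<le> dist a w"
  then show "w \<in> seg z b"
    using assms seg_order[OF assms, of w] unfolding seg_iff by linarith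
qed

lemma seg_split: "z \<in> seg a (b::'a) \<Longrightarrow> seg a b = seg a z \<union> seg z b"
  by (intro set_eqI) (auto simp only: Un_iff seg_left_iff[of z a b] seg_right_iff[of z a b])

lemma seg_split_Int: "z \<in> seg a (b::'a) \<Longrightarrow> seg a z \<inter> seg z b = {z}"
proof -
  assume z: "z \<in> seg a b"
  have "w = z" if "w \<in> seg a z" "w \<in> seg z b" for w
  proof -
    have "w \<in> seg a b" and "dist a w = dist a z"
      using that seg_left_iff[OF z, of w] seg_right_iff[OF z, of w] by linarith+
    then have "dist w z = 0"
      using seg_order[of w a b z] z by linarith
    then show ?thesis by (metis dist_eq_0_iff)
  qed
  then show ?thesis by auto
qed

lemma geo_initial:
  assumes "z \<in> seg a (b::'a)" "t \<in> {0..dist a z}" shows "geo a z t = geo a b t"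
  using assms geo_in_seg[OF assms(2)] seg_sub[OF assms(1)] dist_geo_left[OF assms(2)]
  by (metis geo_dist_seg subsetD)

lemma continuous_on_geo: "continuous_on {0..dist a b} (geo a (b::'a))"
  unfolding continuous_on_iff using dist_geo_geo
  by (metis dist_real_def)

lemma compact_seg: "compact (seg a (b::'a))"
  unfolding seg_def by (intro compact_continuous_image continuous_on_geo) simp

lemma open_seg_eq: "open_seg a b = seg a (b::'a) - {a, b}"
proof (rule set_eqI)
  fix z
  show "z \<in> open_seg a b \<longleftrightarrow> z \<in> seg a b - {a, b}"
  proof
    assume "z \<in> open_seg a b"
    then obtain t where t: "t \<in> {0<..<dist a b}" "z = geo a b t" by (auto simp: open_seg_def)
    then show "z \<in> seg a b - {a, b}"
      using geo_in_seg[of t a b] dist_geo_left[of t a b] dist_geo_right[of t a b]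
      by (metis DiffI atLeastAtMost_iff dist_self empty_iff greaterThanLessThan_iff insert_iff
          less_eq_real_def less_irrefl right_minus_eq)
  next
    assume z: "z \<in> seg a b - {a, b}"
    then have "dist a z \<in> {0<..<dist a b}"
      using seg_iff[of z a b] zero_less_dist_iff[of a z] zero_less_dist_iff[of z b]
      unfolding greaterThanLessThan_iff by (metis DiffE insert_iff less_add_same_cancel1)
    then show "z \<in> open_seg a b"
      using z geo_dist_seg[of z a b] unfolding open_seg_def by (metis DiffD1 imageI)
  qed
qed

text \<open>Two geodesics from \<open>a\<close> agree on a closed set of parameters, and
  \<open>c\<close> is their position at the largest one. A common point has the same parameter on
  both, its distance from \<open>a\<close>, so nothing beyond \<open>c\<close> is shared.\<close>

lemma ex_branch_pt: "\<exists>!c::'a. seg a x \<inter> seg a b = seg a c"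
proof -
  define P where "P = {t \<in> {0..min (dist a x) (dist a b)}. geo a x t = geo a b t}"
  have "closed P"
  proof -
    have "P = {t \<in> {0..min (dist a x) (dist a b)}. dist (geo a x t) (geo a b t) = 0}"
      by (simp add: P_def)
    then show ?thesis
      by (simp only:) (intro continuous_closed_preimage_constant continuous_on_dist
          continuous_on_subset[OF continuous_on_geo]; auto)
  qed
  moreover have "bounded P"
    by (rule bounded_subset[of "{0..min (dist a x) (dist a b)}"]) (auto simp: P_def)
  moreover have "0 \<in> P" by (auto simp: P_def)
  ultimately have "compact P" "P \<noteq> {}"
    by (simp add: compact_eq_bounded_closed, blast)
  then obtain s where s: "s \<in> P" "\<And>t. t \<in> P \<Longrightarrow> t \<le> s"
    using compact_attains_sup[of P] by metis
  define c where "c = geo a x s"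
  have c: "c \<in> seg a x" "c \<in> seg a b" "dist a c = s"
    using s(1) geo_in_seg[of s a x] geo_in_seg[of s a b] dist_geo_left[of s a x]
    by (auto simp: c_def P_def)
  have "seg a x \<inter> seg a b \<subseteq> seg a c"
  proof
    fix z assume z: "z \<in> seg a x \<inter> seg a b"
    then have "dist a z \<in> P"
      using geo_dist_seg seg_dist_bounds[of z a x] seg_dist_bounds[of z a b] by (auto simp: P_def)
    then show "z \<in> seg a c"
      using s(2) c seg_left_iff[of c a x z] z by auto
  qed
  then have "seg a x \<inter> seg a b = seg a c"
    using c seg_sub by blast
  moreover have "c' = c" if "seg a c' = seg a c" for c'
    using seg_ends(2)[of c' a] seg_ends(2)[of c a] that zero_le_dist[of c' c] zero_le_dist[of c c'] unfolding seg_iff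
    by (smt (verit) seg_iff dist_commute dist_eq_0_iff)
  ultimately show ?thesis by metis
qed

lemma branch_pt: "seg a x \<inter> seg a b = seg a (branch_pt a b (x::'a))"
  unfolding branch_pt_def using theI'[OF ex_branch_pt[of a x b]] .

lemma arc_geo:
  assumes "a \<noteq> (b::'a)"
  shows "arc (\<lambda>t. geo a b (t * dist a b))"
proof -
  have *: "t * dist a b \<in> {0..dist a b}" if "t \<in> {0..1}" for t
    using that by (auto simp: mult_left_le_one_le)
  show ?thesis
    unfolding arc_def path_def
  proof (intro conjI inj_onI)
    show "continuous_on {0..1} (\<lambda>t. geo a b (t * dist a b))"
      by (rule continuous_on_compose2[OF continuous_on_geo]) (use * in \<open>auto intro!: continuous_intros\<close>)
    fix s t assume st: "s \<in> {0..1}" "t \<in> {0..1}" "geo a b (s * dist a b) = geo a b (t * dist a b)"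
    then have "s * dist a b = t * dist a b"
      using dist_geo_left[of _ a b] * by metis
    then show "s = t" using assms by simp
  qed
qed

lemma path_image_geo: "path_image (\<lambda>t. geo a b (t * dist a b)) = seg a (b::'a)"
proof (cases "a = b")
  case False
  then show ?thesis
    using R_tree arc_geo[OF False] unfolding R_tree_def
    by (auto simp: pathstart_def pathfinish_def)
next
  case True
  then show ?thesis by (auto simp: path_image_def)
qed

text \<open>Local compactness alone does not give separability, as an uncountable discrete space
  shows; connectedness supplies what is missing.\<close>

lemma connected_tree: "connected (UNIV :: 'a set)"
proof -
  have "path_connected (UNIV :: 'a set)"
    unfolding path_connected_def
  proof (intro ballI)
    fix a b :: 'a
    have "path (\<lambda>t. geo a b (t * dist a b))"
      using arc_geo[of a b] by (cases "a = b") (auto simp: arc_def path_def)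
    then show "\<exists>g. path g \<and> path_image g \<subseteq> UNIV \<and> pathstart g = a \<and> pathfinish g = b"
      by (intro exI[of _ "\<lambda>t. geo a b (t * dist a b)"]) (auto simp: pathstart_def pathfinish_def)
  qed
  then show ?thesis by (rule path_connected_imp_connected)
qed

text \<open>Two arcs that meet only in the branch point join to an injective path, so the second
  axiom of an \<open>\<real>\<close>-tree applies.\<close>

lemma branch_pt_in_seg: "branch_pt a b x \<in> seg x (b::'a)"
proof -
  define c where "c = branch_pt a b x"
  have c: "c \<in> seg a x" "c \<in> seg a b"
  proof -
    have "c \<in> seg a x \<inter> seg a b"
      unfolding c_def branch_pt by simp
    then show "c \<in> seg a x" "c \<in> seg a b" by simp_all
  qed
  \<comment> \<open>A common point lies on both arcs from \<open>a\<close>, hence on the arc from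
    \<open>a\<close> to \<open>c\<close>, yet at least as far from \<open>a\<close> as
    \<open>c\<close>.\<close>
  have Int: "seg x c \<inter> seg c b \<subseteq> {c}"
  proof
    fix z assume z: "z \<in> seg x c \<inter> seg c b"
    then have "z \<in> seg a x \<inter> seg a b" "dist a c \<le> dist a z"
      using seg_right_iff[OF c(1), of z] seg_right_iff[OF c(2), of z] by (auto simp: seg_commute)
    then have "z \<in> seg a c" using branch_pt[of a x b] by (auto simp: c_def)
    then show "z \<in> {c}"
      using \<open>dist a c \<le> dist a z\<close> zero_le_dist[of z c] unfolding seg_iff
      by (metis add_le_same_cancel1 dist_eq_0_iff order_antisym order_trans singletonI)
  qed
  show ?thesis
  proof (cases "c = x \<or> c = b")
    case False
    define g h where "g = (\<lambda>t. geo x c (t * dist x c))" and "h = (\<lambda>t. geo c b (t * dist c b))"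
    have ends: "pathstart g = x" "pathfinish g = c" "pathstart h = c" "pathfinish h = b"
      by (simp_all add: g_def h_def pathstart_def pathfinish_def)
    have img: "path_image g = seg x c" "path_image h = seg c b"
      by (simp_all only: g_def h_def path_image_geo)
    have "arc (g +++ h)"
    proof (rule arc_join)
      show "arc g" "arc h"
        unfolding g_def h_def using False by (metis arc_geo)+
    qed (simp_all add: ends img Int)
    then have "path_image (g +++ h) = seg (pathstart (g +++ h)) (pathfinish (g +++ h))"
      using R_tree unfolding R_tree_def by blast
    then have "seg x c \<union> seg c b = seg x b"
      by (simp add: path_image_join ends img)
    then show ?thesis
      unfolding c_def[symmetric] by (metis UnI1 seg_ends(2))
  qed (auto simp: c_def)
qed

text \<open>In a tree this is the length of the common part of the arcs from \<open>a\<close> to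
  \<open>x\<close> and to \<open>y\<close>, expressed by distances alone.\<close>

definition gromov :: "'a \<Rightarrow> 'a \<Rightarrow> 'a \<Rightarrow> real" where
  "gromov a x y = (dist a x + dist a y - dist x y) / 2"

text \<open>The meet lies on all three arcs between \<open>a\<close>, \<open>x\<close> and
  \<open>y\<close>. The three resulting distance equations are solved by the Gromov product.\<close>

lemma meet: "seg a x \<inter> seg a y = seg a (meet a x y)" "meet a x y \<in> seg a (x::'a)"
    "meet a x y \<in> seg a y" "meet a x y \<in> seg x y" "dist a (meet a x y) = gromov a x y"
proof -
  show 1: "seg a x \<inter> seg a y = seg a (meet a x y)"
    using branch_pt[of a y x] by (simp add: meet_def Int_commute)
  have "meet a x y \<in> seg a x \<inter> seg a y"
    unfolding 1 by simp
  then show "meet a x y \<in> seg a x" "meet a x y \<in> seg a y"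
    by simp_all
  moreover show "meet a x y \<in> seg x y"
    using branch_pt_in_seg[of a x y] by (simp add: meet_def seg_commute)
  ultimately show "dist a (meet a x y) = gromov a x y"
    by (auto simp: seg_iff gromov_def dist_commute)
qed

lemma gromov_bounds: "0 \<le> gromov a x y" "gromov a x y \<le> dist a x" "gromov a x y \<le> dist a y"
  using seg_dist_bounds[OF meet(2)[of a x y]] seg_dist_bounds[OF meet(3)[of a x y]] meet(5)[of a x y]
  by auto

lemma seg_Int_iff:
  "z \<in> seg a x \<and> z \<in> seg a y \<longleftrightarrow> z \<in> seg a (x::'a) \<and> dist a z \<le> gromov a x y"
proof -
  have "z \<in> seg a x \<and> z \<in> seg a y \<longleftrightarrow> z \<in> seg a (meet a x y)"
    unfolding meet(1)[symmetric] by simp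
  then show ?thesis
    unfolding seg_left_iff[OF meet(2)] meet(5) .
qed

text \<open>The arc from \<open>x\<close> to \<open>y\<close> runs through the meet, and each half
  is part of an arc from \<open>a\<close>. Thus arbitrary arcs reduce to arcs from the root.\<close>

lemma seg_subset_Un: "seg x y \<subseteq> seg a x \<union> seg a (y::'a)"
proof -
  have "seg x (meet a x y) \<subseteq> seg a x"
    using seg_sub2[OF meet(2)] by (simp add: seg_commute)
  moreover have "seg (meet a x y) y \<subseteq> seg a y"
    by (rule seg_sub2[OF meet(3)])
  ultimately show ?thesis
    using seg_split[OF meet(4)[of a x y]] by (metis Un_mono)
qed

lemma geo_agree:
  assumes "t \<in> {0..gromov a x y}" shows "geo a x t = geo a y t"
  using assms unfolding meet(5)[symmetric]
  using geo_initial[OF meet(2)[of a x y], of t] geo_initial[OF meet(3)[of a x y], of t] by metis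

end

section \<open>Separability\<close>

lemma compact_countable_dense:
  fixes K :: "'a::metric_space set"
  assumes "compact K"
  shows "\<exists>D. countable D \<and> K \<subseteq> closure D"
proof -
  have "\<forall>n::nat. \<exists>F. finite F \<and> K \<subseteq> (\<Union>x\<in>F. ball x (1 / real (Suc n)))"
    using assms unfolding compact_eq_totally_bounded by (metis of_nat_0_less_iff zero_less_Suc zero_less_divide_1_iff)
  then obtain F where F: "\<And>n. finite (F n)" "\<And>n::nat. K \<subseteq> (\<Union>x\<in>F n. ball x (1 / real (Suc n)))"
    by metis
  have "K \<subseteq> closure (\<Union>n. F n)"
  proof
    fix y assume y: "y \<in> K"
    show "y \<in> closure (\<Union>n. F n)"
      unfolding closure_approachable
    proof (intro allI impI)
      fix e :: real assume "e > 0"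
      then obtain n where n: "1 / real (Suc n) < e"
        by (metis nat_approx_posE)
      obtain x where "x \<in> F n" "dist x y < 1 / real (Suc n)"
        using F(2)[of n] y by auto
      then show "\<exists>x\<in>\<Union>n. F n. dist x y < e"
        using n by force
    qed
  qed
  then show ?thesis
    using F(1) by (intro exI[of _ "\<Union>n. F n"]) (auto intro: countable_finite)
qed

lemma locally_compact_cball:
  assumes "locally compact (UNIV :: 'a::metric_space set)"
  shows "\<exists>R>0. \<forall>r\<le>R. compact (cball (x::'a) r)"
proof -
  obtain u v where uv: "openin (top_of_set UNIV) u" "compact v" "x \<in> u" "u \<subseteq> v"
    using locallyE[OF assms, of UNIV x] by auto
  then obtain R where R: "R > 0" "cball x R \<subseteq> u"
    by (metis open_contains_cball open_openin subtopology_UNIV)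
  have "compact (cball x r)" if "r \<le> R" for r
  proof -
    have "cball x r \<subseteq> v" using that R(2) uv(4) subset_cball by blast
    then show ?thesis
      using compact_Int_closed[OF uv(2), of "cball x r"] by (simp add: Int_absorb1)
  qed
  then show ?thesis using R(1) by blast
qed

text \<open>The closure of a countable set that contains a dense subset of each of its small compact
  balls is open, hence everything.\<close>

lemma connected_locally_compact_separable:
  assumes conn: "connected (UNIV :: 'a::metric_space set)"
    and lc: "locally compact (UNIV :: 'a set)"
  shows "\<exists>X :: nat \<Rightarrow> 'a. \<forall>x. \<forall>e>0. \<exists>n. dist (X n) x < e"
proof -
  have "\<forall>K :: 'a set. \<exists>D. compact K \<longrightarrow> countable D \<and> K \<subseteq> closure D"
    using compact_countable_dense by blast
  then obtain D where D: "\<And>K :: 'a set. compact K \<Longrightarrow> countable (D K) \<and> K \<subseteq> closure (D K)"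
    by metis
  \<comment> \<open>Only the radii \<open>1 / Suc m\<close> are tried, so that \<open>E d\<close> is
    a countable union; balls that are not compact are skipped.\<close>
  define E where "E d = (\<Union>m\<in>{m. compact (cball d (1 / real (Suc m)))}. D (cball d (1 / real (Suc m))))" for d :: 'a
  define step where "step C = (\<Union>d\<in>C. E d)" for C
  define S where "S n = (step ^^ n) {undefined :: 'a}" for n
  define C where "C = (\<Union>n. S n)"
  have "countable (S n)" for n
  proof (induction n)
    case (Suc n)
    then show ?case using D by (auto simp: S_def step_def E_def intro!: countable_UN)
  qed (simp add: S_def)
  then have count: "countable C" by (simp add: C_def)
  have step: "E d \<subseteq> C" if d: "d \<in> C" for d
  proof -
    obtain n where "d \<in> S n" using d by (auto simp: C_def)
    then have "E d \<subseteq> S (Suc n)" by (auto simp: S_def step_def)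
    then show ?thesis by (auto simp: C_def)
  qed
  have "open (closure C)"
    unfolding open_contains_ball
  proof
    fix y assume y: "y \<in> closure C"
    obtain R where R: "R > 0" "\<And>r. r \<le> R \<Longrightarrow> compact (cball y r)"
      using locally_compact_cball[OF lc] by metis
    obtain m where m: "1 / real (Suc m) < R / 2"
      using R(1) by (metis half_gt_zero nat_approx_posE)
    \<comment> \<open>With \<open>d\<close> within \<open>e / 2\<close> of \<open>y\<close> and
      \<open>e < R / 2\<close>, the ball of radius \<open>e\<close> about \<open>d\<close> stays
      inside the compact ball about \<open>y\<close> and still contains a ball about
      \<open>y\<close>.\<close>
    define e where "e = 1 / real (Suc m)"
    have e: "e > 0" "e < R / 2" using m by (auto simp: e_def)
    obtain d where d: "d \<in> C" "dist d y < e / 2"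
      using y e(1) unfolding closure_approachable by (metis half_gt_zero)
    have "cball d e \<subseteq> cball y R"
    proof
      fix z assume "z \<in> cball d e"
      then show "z \<in> cball y R"
        using dist_triangle[of y z d] d(2) e by (simp add: dist_commute)
    qed
    then have "compact (cball d e)"
      using compact_Int_closed[OF R(2)[OF order_refl], of "cball d e"] by (simp add: Int_absorb1)
    then have "D (cball d e) \<subseteq> C" "cball d e \<subseteq> closure (D (cball d e))"
      using step[OF d(1)] D by (auto simp: E_def e_def)
    then have "cball d e \<subseteq> closure C"
      using closure_mono by blast
    moreover have "ball y (e / 2) \<subseteq> cball d e"
    proof
      fix z assume "z \<in> ball y (e / 2)"
      then show "z \<in> cball d e"
        using dist_triangle[of d z y] d(2) by simp
    qed
    ultimately show "\<exists>e>0. ball y e \<subseteq> closure C"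
      using e(1) by (metis half_gt_zero order_trans)
  qed
  moreover have "undefined \<in> S 0" by (simp add: S_def)
  then have "undefined \<in> C" by (auto simp: C_def)
  ultimately have "closure C = UNIV"
    using conn closure_subset[of C] unfolding connected_clopen by (auto simp: open_openin[symmetric] closed_closedin[symmetric])
  then have "\<forall>x. \<forall>e>0. \<exists>n. dist (from_nat_into C n) x < e"
    using count \<open>undefined \<in> C\<close> unfolding closure_approachable set_eq_iff
    by (metis UNIV_I empty_iff from_nat_into_surj)
  then show ?thesis by blast
qed

section \<open>The length measure\<close>

text \<open>The dense sequence is a parameter so that a measure can be defined from it;
  \<open>length_measure_unique\<close> later shows that the choice does not affect the
  measure.\<close>

locale separable_tree = real_tree T
  for T :: "'a::metric_space itself" +
  fixes \<rho> :: 'a and X :: "nat \<Rightarrow> 'a"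
  assumes dense: "e > 0 \<Longrightarrow> \<exists>n. dist (X n) x < e"
begin

definition arc_measure :: "'a \<Rightarrow> 'a measure" where
  "arc_measure x = distr (restrict_space lborel {0..dist \<rho> x}) borel (geo \<rho> x)"

lemma measurable_geo [measurable]: "geo \<rho> x \<in> borel_measurable (restrict_space lborel {0..dist \<rho> x})"
proof -
  have eq: "sets (restrict_space lborel {0..dist \<rho> x}) = sets (restrict_space borel {0..dist \<rho> x})"
    by (intro sets_restrict_space_cong) simp
  show ?thesis
    unfolding measurable_cong_sets[OF eq refl]
    by (intro borel_measurable_continuous_on_restrict continuous_on_geo)
qed

lemma sets_arc_measure [simp, measurable_cong]: "sets (arc_measure x) = sets borel"
  by (simp add: arc_measure_def)

lemma borel_preimage_geo:
  assumes "B \<in> sets borel" shows "{t \<in> {0..dist \<rho> x}. geo \<rho> x t \<in> B} \<in> sets borel"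
proof -
  have "geo \<rho> x -` B \<inter> space (restrict_space lborel {0..dist \<rho> x}) \<in> sets (restrict_space lborel {0..dist \<rho> x})"
    using assms by measurable
  moreover have "geo \<rho> x -` B \<inter> space (restrict_space lborel {0..dist \<rho> x}) = {t \<in> {0..dist \<rho> x}. geo \<rho> x t \<in> B}"
    by (auto simp: space_restrict_space)
  ultimately show ?thesis
    by (auto simp: sets_restrict_space_iff)
qed

lemma emeasure_arc_measure:
  assumes "B \<in> sets borel"
  shows "emeasure (arc_measure x) B = emeasure lborel {t \<in> {0..dist \<rho> x}. geo \<rho> x t \<in> B}"
proof -
  have "geo \<rho> x -` B \<inter> space (restrict_space lborel {0..dist \<rho> x}) = {t \<in> {0..dist \<rho> x}. geo \<rho> x t \<in> B}"
    by (auto simp: space_restrict_space)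
  then have "emeasure (arc_measure x) B =
      emeasure (restrict_space lborel {0..dist \<rho> x}) {t \<in> {0..dist \<rho> x}. geo \<rho> x t \<in> B}"
    unfolding arc_measure_def using assms by (subst emeasure_distr) auto
  also have "\<dots> = emeasure lborel {t \<in> {0..dist \<rho> x}. geo \<rho> x t \<in> B}"
    by (rule emeasure_restrict_space) auto
  finally show ?thesis .
qed

lemma seg_borel [measurable]: "seg a (b::'a) \<in> sets borel"
  by (intro borel_closed compact_imp_closed compact_seg)

lemma open_seg_borel [measurable]: "open_seg a (b::'a) \<in> sets borel"
  unfolding open_seg_eq by (intro sets.Diff seg_borel borel_closed finite_imp_closed) auto

lemma singleton_borel [measurable]: "{p::'a} \<in> sets borel"
  by (intro borel_closed) simp

text \<open>A point on both arcs has the same parameter on each, its distance from the root, so the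
  two preimages of \<open>B\<close> are the same set. This is what makes the arc measures fit
  together.\<close>

lemma arc_measure_consistent:
  assumes "B \<in> sets borel" "B \<subseteq> seg \<rho> x" "B \<subseteq> seg \<rho> y"
  shows "emeasure (arc_measure x) B = emeasure (arc_measure y) B"
proof -
  have *: "t \<in> {0..dist \<rho> y} \<and> geo \<rho> y t \<in> B"
    if xy: "B \<subseteq> seg \<rho> x" "B \<subseteq> seg \<rho> y" and t: "t \<in> {0..dist \<rho> x}" "geo \<rho> x t \<in> B" for x y t
  proof -
    have "geo \<rho> x t \<in> seg \<rho> x" "geo \<rho> x t \<in> seg \<rho> y" using xy t by blast+
    then have "t \<le> gromov \<rho> x y"
      using seg_Int_iff[of "geo \<rho> x t" \<rho> x y] dist_geo_left[OF t(1)] by simp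
    then show ?thesis
      using t geo_agree[of t \<rho> x y] gromov_bounds(3)[of \<rho> x y] by simp
  qed
  have "{t \<in> {0..dist \<rho> x}. geo \<rho> x t \<in> B} = {t \<in> {0..dist \<rho> y}. geo \<rho> y t \<in> B}"
    using *[of x y] *[of y x] assms(2,3) by blast
  then show ?thesis
    using assms(1) by (simp only: emeasure_arc_measure)
qed

lemma arc_measure_singleton: "emeasure (arc_measure x) {p} = 0"
proof -
  have "{t \<in> {0..dist \<rho> x}. geo \<rho> x t \<in> {p}} \<subseteq> {dist \<rho> p}"
    using dist_geo_left by auto
  then have "emeasure lborel {t \<in> {0..dist \<rho> x}. geo \<rho> x t \<in> {p}} \<le> emeasure lborel {dist \<rho> p}"
    by (intro emeasure_mono) auto
  then show ?thesis
    by (simp add: emeasure_arc_measure)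
qed

lemma arc_measure_seg:
  assumes c: "c \<in> seg \<rho> x"
  shows "emeasure (arc_measure x) (seg c x) = ennreal (dist c x)"
proof -
  have "{t \<in> {0..dist \<rho> x}. geo \<rho> x t \<in> seg c x} = {dist \<rho> c..dist \<rho> x}"
  proof (rule set_eqI)
    fix t
    have "dist \<rho> c \<le> t \<Longrightarrow> 0 \<le> t" using zero_le_dist[of \<rho> c] by linarith
    then show "t \<in> {t \<in> {0..dist \<rho> x}. geo \<rho> x t \<in> seg c x} \<longleftrightarrow> t \<in> {dist \<rho> c..dist \<rho> x}"
      using seg_right_iff[OF c, of "geo \<rho> x t"] geo_in_seg[of t \<rho> x] dist_geo_left[of t \<rho> x]
      by (cases "t \<in> {0..dist \<rho> x}") auto
  qed
  moreover have "dist \<rho> x - dist \<rho> c = dist c x" "dist \<rho> c \<le> dist \<rho> x"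
    using c seg_dist_bounds[OF c] by (auto simp: seg_iff)
  ultimately show ?thesis
    by (simp add: emeasure_arc_measure)
qed

lemma arc_measure_Un_singleton:
  assumes "A \<in> sets borel" "B \<in> sets borel" "A \<subseteq> B" "B \<subseteq> insert p A"
  shows "emeasure (arc_measure x) A = emeasure (arc_measure x) B"
proof (rule emeasure_eq_AE)
  have "AE z in arc_measure x. z \<noteq> p"
    using arc_measure_singleton[of x p] by (intro AE_I[where N = "{p}"]) auto
  then show "AE z in arc_measure x. z \<in> A \<longleftrightarrow> z \<in> B"
    using assms(3,4) by (auto elim!: eventually_mono)
qed (use assms in auto)

text \<open>If \<open>X n\<close> is closer to \<open>x\<close> than \<open>z\<close> is, the arcs
  from the root to \<open>x\<close> and to \<open>X n\<close> separate only beyond \<open>z\<close>.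
  The endpoint is excluded because a leaf lies on arcs from the root only as an endpoint and may be
  missing from the sequence.\<close>

lemma seg_covered:
  assumes "z \<in> seg \<rho> x" "z \<noteq> x"
  shows "\<exists>n. z \<in> seg \<rho> (X n) \<and> z \<noteq> X n"
proof -
  obtain n where n: "dist (X n) x < dist z x"
    using dense[of "dist z x" x] assms(2) by (metis zero_less_dist_iff)
  have "dist \<rho> z \<le> gromov \<rho> x (X n)"
    using n assms(1) dist_triangle[of \<rho> x "X n"] unfolding gromov_def seg_iff
    by (simp add: dist_commute)
  then show ?thesis
    using seg_Int_iff[of z \<rho> x "X n"] assms(1) n by blast
qed

section \<open>Gluing the arc measures along disjoint pieces\<close>

definition piece :: "nat \<Rightarrow> 'a set" where
  "piece n = seg \<rho> (X n) - (\<Union>i<n. seg \<rho> (X i))"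

lemma piece_borel [measurable]: "piece n \<in> sets borel"
  unfolding piece_def by measurable

lemma piece_subset: "piece n \<subseteq> seg \<rho> (X n)"
  by (auto simp: piece_def)

lemma disjoint_piece: "disjoint_family piece"
  unfolding disjoint_family_on_def
proof (intro ballI impI)
  have *: "piece m \<inter> piece n = {}" if "m < n" for m n
    using that by (auto simp: piece_def)
  fix m n :: nat assume "m \<noteq> n"
  then show "piece m \<inter> piece n = {}"
    using *[of m n] *[of n m] by (cases "m < n") auto
qed

lemma UN_piece: "(\<Union>n. piece n) = (\<Union>n. seg \<rho> (X n))"
proof (intro equalityI subsetI)
  fix z assume "z \<in> (\<Union>n. seg \<rho> (X n))"
  then have ex: "\<exists>n. z \<in> seg \<rho> (X n)" by blast
  have "z \<in> piece (LEAST n. z \<in> seg \<rho> (X n))"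
    using LeastI_ex[OF ex] not_less_Least by (auto simp: piece_def)
  then show "z \<in> (\<Union>n. piece n)" by blast
qed (use piece_subset in blast)

text \<open>The pieces can miss at most the endpoint \<open>x\<close> of the arc, and points have no
  mass.\<close>

lemma arc_measure_pieces:
  assumes B: "B \<in> sets borel" "B \<subseteq> seg \<rho> x"
  shows "emeasure (arc_measure x) B = emeasure (arc_measure x) (\<Union>n. B \<inter> piece n)"
proof (rule arc_measure_Un_singleton[symmetric, of _ _ x])
  show "B \<subseteq> insert x (\<Union>n. B \<inter> piece n)"
  proof
    fix z assume z: "z \<in> B"
    show "z \<in> insert x (\<Union>n. B \<inter> piece n)"
    proof (cases "z = x")
      case False
      then have "z \<in> (\<Union>n. piece n)"
        unfolding UN_piece using seg_covered z B(2) by blast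
      then show ?thesis using z by blast
    qed simp
  qed
  show "(\<Union>n. B \<inter> piece n) \<in> sets borel"
    using B(1) by measurable
  show "(\<Union>n. B \<inter> piece n) \<subseteq> B" by blast
qed (rule B(1))

text \<open>The sum over \<open>n\<close> is written as an integral against counting measure, so
  that countable additivity becomes the interchange of a series with an integral.\<close>

definition tree_measure :: "'a measure" where
  "tree_measure = measure_of UNIV (sets borel)
     (\<lambda>B. \<integral>\<^sup>+n. emeasure (arc_measure (X n)) (B \<inter> piece n) \<partial>count_space UNIV)"

lemma sets_tree_measure [simp, measurable_cong]: "sets tree_measure = sets borel"
  unfolding tree_measure_def using sets.sets_measure_of_eq[of borel] by simp

lemma emeasure_tree_measure:
  assumes "B \<in> sets borel"
  shows "emeasure tree_measure B = (\<integral>\<^sup>+n. emeasure (arc_measure (X n)) (B \<inter> piece n) \<partial>count_space UNIV)"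
proof (rule emeasure_measure_of[OF tree_measure_def])
  show "countably_additive (sets tree_measure)
     (\<lambda>B. \<integral>\<^sup>+n. emeasure (arc_measure (X n)) (B \<inter> piece n) \<partial>count_space UNIV)"
    unfolding countably_additive_def
  proof (intro allI impI)
    fix A :: "nat \<Rightarrow> 'a set" assume A: "range A \<subseteq> sets tree_measure" "disjoint_family A"
    have "(\<Sum>i. emeasure (arc_measure (X n)) (A i \<inter> piece n)) = emeasure (arc_measure (X n)) (\<Union> (range A) \<inter> piece n)" for n
    proof (subst suminf_emeasure)
      show "range (\<lambda>i. A i \<inter> piece n) \<subseteq> sets (arc_measure (X n))" using A(1) by auto
      show "disjoint_family (\<lambda>i. A i \<inter> piece n)"
        using A(2) by (auto simp: disjoint_family_on_def)
    qed simp
    then show "(\<Sum>i. \<integral>\<^sup>+n. emeasure (arc_measure (X n)) (A i \<inter> piece n) \<partial>count_space UNIV) =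
        (\<integral>\<^sup>+n. emeasure (arc_measure (X n)) (\<Union> (range A) \<inter> piece n) \<partial>count_space UNIV)"
      by (subst nn_integral_suminf[symmetric]) auto
  qed
qed (use assms in \<open>auto simp: positive_def\<close>)

text \<open>By consistency \<open>X n\<close> may be replaced by \<open>x\<close> in every summand;
  what remains is one measure summed over disjoint sets.\<close>

lemma tree_measure_arc:
  assumes B: "B \<in> sets borel" "B \<subseteq> seg \<rho> x"
  shows "emeasure tree_measure B = emeasure (arc_measure x) B"
proof -
  have "emeasure (arc_measure (X n)) (B \<inter> piece n) = emeasure (arc_measure x) (B \<inter> piece n)" for n
    using B piece_subset by (intro arc_measure_consistent) auto
  then have "emeasure tree_measure B = (\<Sum>n. emeasure (arc_measure x) (B \<inter> piece n))"
    using B(1) by (simp add: emeasure_tree_measure nn_integral_count_space_nat)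
  also have "\<dots> = emeasure (arc_measure x) (\<Union>n. B \<inter> piece n)"
    using B(1) disjoint_piece by (intro suminf_emeasure) (auto simp: disjoint_family_on_def)
  also have "\<dots> = emeasure (arc_measure x) B"
    using arc_measure_pieces[OF B] by simp
  finally show ?thesis .
qed

section \<open>The skeleton; existence and uniqueness of the length measure\<close>

lemma open_seg_in_skeleton: "open_seg a b \<subseteq> (skeleton :: 'a set)"
  by (auto simp: skeleton_def)

text \<open>The root is inserted because it can be interior to some arc although it is an endpoint
  of every arc used here.\<close>

lemma skeleton_covered: "skeleton \<subseteq> insert \<rho> (\<Union>n. open_seg \<rho> (X n))"
proof
  fix z :: 'a assume "z \<in> skeleton"
  then obtain a b where z: "z \<in> seg a b" "z \<noteq> a" "z \<noteq> b"
    by (auto simp: skeleton_def open_seg_eq)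
  then have "z \<in> seg \<rho> a \<or> z \<in> seg \<rho> b"
    using seg_subset_Un by blast
  then obtain n where "z \<in> seg \<rho> (X n)" "z \<noteq> X n"
    using seg_covered z by metis
  then show "z \<in> insert \<rho> (\<Union>n. open_seg \<rho> (X n))"
    by (auto simp: open_seg_eq)
qed

lemma skeleton_subset: "(skeleton :: 'a set) \<subseteq> (\<Union>n. seg \<rho> (X n))"
  using skeleton_covered by (fastforce simp: open_seg_eq)

text \<open>The uncountable union that defines the skeleton differs from a countable union of Borel
  sets by at most the root.\<close>

lemma skeleton_borel [measurable]: "(skeleton :: 'a set) \<in> sets borel"
proof -
  let ?V = "\<Union>n. open_seg \<rho> (X n)"
  have "?V \<subseteq> skeleton" using open_seg_in_skeleton by blast
  then have "skeleton = ?V \<or> skeleton = insert \<rho> ?V"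
    using skeleton_covered by blast
  moreover have "?V \<in> sets borel" by measurable
  ultimately show ?thesis by (metis sets_borel insert_is_Un sets.Un singleton_borel)
qed

text \<open>A point of the skeleton cuts an open arc into two open arcs whose lengths already add up
  to the total, so no mass is left for it. All other points lie in the null complement.\<close>

lemma null_points:
  assumes M: "is_length_measure (M :: 'a measure)"
  shows "emeasure M {p} = 0"
proof (cases "p \<in> skeleton")
  case True
  have sets: "sets M = sets borel" using M by (simp add: is_length_measure_def)
  have len: "emeasure M (open_seg a b) = ennreal (dist a b)" for a b :: 'a
    using M by (simp add: is_length_measure_def)
  obtain a b where p: "p \<in> seg a b" "p \<noteq> a" "p \<noteq> b"
    using True by (auto simp: skeleton_def open_seg_eq)
  have Int: "seg a p \<inter> seg p b = {p}" by (rule seg_split_Int[OF p(1)])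
  have "a \<notin> seg p b" "b \<notin> seg a p" using p Int by (metis Int_iff seg_ends singletonD)+
  then have eq: "open_seg a b = (open_seg a p \<union> open_seg p b) \<union> {p}"
    using p unfolding open_seg_eq seg_split[OF p(1)] by auto
  have "ennreal (dist a b) = emeasure M (open_seg a p \<union> open_seg p b) + emeasure M {p}"
    unfolding len[symmetric] eq
    by (rule plus_emeasure[symmetric]) (auto simp: sets open_seg_eq)
  also have "emeasure M (open_seg a p \<union> open_seg p b) = ennreal (dist a p) + ennreal (dist p b)"
    unfolding len[symmetric] using Int by (intro plus_emeasure[symmetric]) (auto simp: sets open_seg_eq)
  also have "\<dots> = ennreal (dist a b)"
    using p(1) by (simp add: seg_iff flip: ennreal_plus)
  finally show ?thesis
    by (metis add.right_neutral ennreal_add_left_cancel ennreal_neq_top infinity_ennreal_def)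
next
  case False
  have "UNIV - skeleton \<in> null_sets M" and sets: "sets M = sets borel"
    using M by (simp_all add: is_length_measure_def)
  moreover have "{p} \<in> sets M"
    unfolding sets by (rule singleton_borel)
  ultimately have "{p} \<in> null_sets M"
    using False by (intro null_sets_subset[of "UNIV - skeleton" M "{p}"]) simp_all
  then show ?thesis by (rule null_setsD1)
qed

lemma length_measure_seg_Diff:
  assumes M: "is_length_measure (M :: 'a measure)" and F: "finite F" "F \<subseteq> {a, b}"
  shows "emeasure M (seg a b - F) = ennreal (dist a b)"
proof -
  have sets: "sets M = sets borel" using M by (simp add: is_length_measure_def)
  have "AE z in M. z \<noteq> p" for p
    using null_points[OF M, of p] by (intro AE_I[where N = "{p}"]) (auto simp: sets)
  then have "AE z in M. z \<noteq> a \<and> z \<noteq> b" by simp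
  then have "AE z in M. z \<in> seg a b - F \<longleftrightarrow> z \<in> open_seg a b"
    by (rule eventually_mono) (use F in \<open>auto simp: open_seg_eq\<close>)
  moreover have "F \<in> sets borel" using F by (intro borel_closed finite_imp_closed)
  ultimately have "emeasure M (seg a b - F) = emeasure M (open_seg a b)"
    by (intro emeasure_eq_AE) (auto simp: sets)
  then show ?thesis using M by (simp add: is_length_measure_def)
qed

text \<open>Distance from the root is injective on the arc and carries \<open>M\<close> to a measure
  on the line. That image agrees with Lebesgue measure on \<open>{0..d}\<close> on all rays, since a
  ray pulls back to a final part of the arc, whose mass is its length; rays determine a finite
  measure.\<close>

lemma length_measure_arc:
  assumes M: "is_length_measure (M :: 'a measure)" and B: "B \<in> sets borel" "B \<subseteq> seg \<rho> x"
  shows "emeasure M B = emeasure (arc_measure x) B"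
proof -
  have sets [measurable_cong, simp]: "sets M = sets borel"
    using M by (simp add: is_length_measure_def)
  have sp [simp]: "space M = UNIV" using sets_eq_imp_space_eq[OF sets] by simp
  define d where "d = dist \<rho> x"
  have d0: "0 \<le> d" by (simp add: d_def)
  have [measurable]: "dist \<rho> \<in> borel_measurable borel"
    by (intro borel_measurable_continuous_onI continuous_intros)
  define N where "N = distr (density M (indicator (seg \<rho> x))) borel (dist \<rho>)"
  have N: "emeasure N E = emeasure M {z \<in> seg \<rho> x. dist \<rho> z \<in> E}" if [measurable]: "E \<in> sets borel" for E
  proof -
    have "emeasure N E = emeasure (density M (indicator (seg \<rho> x))) (dist \<rho> -` E)"
      unfolding N_def by (subst emeasure_distr) auto
    also have "\<dots> = (\<integral>\<^sup>+z. indicator (seg \<rho> x \<inter> dist \<rho> -` E) z \<partial>M)"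
      using measurable_sets[of "dist \<rho>" borel borel E]
      by (subst emeasure_density) (auto intro!: nn_integral_cong split: split_indicator simp del: nn_integral_indicator)
    also have "\<dots> = emeasure M (seg \<rho> x \<inter> dist \<rho> -` E)"
      using measurable_sets[of "dist \<rho>" borel borel E] by (intro nn_integral_indicator) auto
    finally show ?thesis by (simp add: vimage_def Int_def)
  qed
  have L: "emeasure (density lborel (indicator {0..d})) E = emeasure lborel ({0..d} \<inter> E)" if "E \<in> sets borel" for E
    using that by (simp add: emeasure_density flip: indicator_inter_arith)
  have eq: "emeasure N {t<..} = emeasure (density lborel (indicator {0..d})) {t<..}" for t
  proof -
    consider "t < 0" | "t \<ge> d" | "0 \<le> t" "t < d" by linarith
    then show ?thesis
    proof cases
      case 1
      then have "{z \<in> seg \<rho> x. t < dist \<rho> z} = seg \<rho> x - {}" "{0..d} \<inter> {t<..} = {0..d}"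
        using zero_le_dist by (auto intro: less_le_trans)
      then show ?thesis
        using length_measure_seg_Diff[OF M, of "{}" \<rho> x] d0 by (simp add: N L flip: d_def)
    next
      case 2
      then have "{z \<in> seg \<rho> x. t < dist \<rho> z} = {}" "{0..d} \<inter> {t<..} = {}"
        using seg_dist_bounds by (force simp: d_def)+
      then have "emeasure M {z \<in> seg \<rho> x. t < dist \<rho> z} = 0" "emeasure lborel ({0..d} \<inter> {t<..}) = 0"
        by (simp_all only: emeasure_empty)
      then show ?thesis by (simp add: N L)
    next
      case 3
      define c where "c = geo \<rho> x t"
      have c: "c \<in> seg \<rho> x" "dist \<rho> c = t" "dist c x = d - t"
        using 3 geo_in_seg[of t \<rho> x] dist_geo_left[of t \<rho> x] dist_geo_right[of t \<rho> x] by (auto simp: c_def d_def)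
      have "z \<in> seg c x - {c} \<longleftrightarrow> z \<in> seg \<rho> x \<and> t < dist \<rho> z" for z
      proof -
        have "z = c" if "z \<in> seg \<rho> x" "dist \<rho> z = t"
          using geo_dist_seg[OF that(1)] that(2) by (simp add: c_def)
        then show ?thesis
          using seg_right_iff[OF c(1), of z] c(2) by force
      qed
      then have "{z \<in> seg \<rho> x. t < dist \<rho> z} = seg c x - {c}" by blast
      moreover have "{0..d} \<inter> {t<..} = {t<..d}" using 3 by auto
      ultimately show ?thesis
        using length_measure_seg_Diff[OF M, of "{c}" c x] 3 c(3) by (simp add: N L)
    qed
  qed
  have "N = density lborel (indicator {0..d})"
  proof (rule measure_eqI_lessThan[OF _ _ _ eq])
    show "emeasure N {t<..} < \<infinity>" for t
    proof -
      have "emeasure lborel ({0..d} \<inter> {t<..}) \<le> emeasure lborel {0..d}"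
        by (intro emeasure_mono) auto
      also have "\<dots> < \<infinity>"
        using d0 by simp
      finally show ?thesis
        unfolding eq by (subst L) simp_all
    qed
  qed (auto simp: N_def)
  then have N': "emeasure N E = emeasure lborel ({0..d} \<inter> E)" if "E \<in> sets borel" for E
    using L that by simp
  define E where "E = {t \<in> {0..d}. geo \<rho> x t \<in> B}"
  have E: "E \<in> sets borel" using borel_preimage_geo[OF B(1)] by (simp add: E_def d_def)
  have "z \<in> seg \<rho> x \<and> dist \<rho> z \<in> E \<longleftrightarrow> z \<in> B" for z
    using geo_dist_seg[of z \<rho> x] seg_dist_bounds[of z \<rho> x] B(2) by (auto simp: E_def d_def)
  then have "{z \<in> seg \<rho> x. dist \<rho> z \<in> E} = B" by blast
  then have "emeasure M B = emeasure lborel ({0..d} \<inter> E)"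
    using N[OF E] N'[OF E] by simp
  also have "{0..d} \<inter> E = E" by (auto simp: E_def)
  finally show ?thesis
    by (simp add: emeasure_arc_measure[OF B(1)] E_def d_def)
qed

lemma tree_measure_length_measure: "is_length_measure tree_measure"
proof -
  have open_seg: "emeasure tree_measure (open_seg a b) = ennreal (dist a b)" for a b
  proof -
    \<comment> \<open>The construction knows only arcs from the root, so the arc from
      \<open>a\<close> to \<open>b\<close> is cut at the meet into two legs that lie on such
      arcs.\<close>
    define c where "c = meet \<rho> a b"
    note c = meet(2-4)[of \<rho> a b, folded c_def]
    have null: "{p} \<in> null_sets tree_measure" for p
      using tree_measure_arc[of "{p}" p] by (intro null_setsI) (auto simp: arc_measure_singleton)
    have leg: "emeasure tree_measure (seg c x) = ennreal (dist c x)" if "c \<in> seg \<rho> x" for x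
      using that seg_sub2[OF that] by (subst tree_measure_arc[of _ x]) (auto simp: arc_measure_seg)
    have "{a, b, c} \<in> null_sets tree_measure"
      using null[of a] null[of b] null[of c] by (metis insert_is_Un null_sets.Un)
    then have "AE z in tree_measure. z \<notin> {a, b, c}" by (rule AE_not_in)
    then have ae: "AE z in tree_measure. z \<noteq> a \<and> z \<noteq> b \<and> z \<noteq> c" by simp
    have "emeasure tree_measure (open_seg a b) = emeasure tree_measure (seg c a \<union> (seg c b - {c}))"
      by (intro emeasure_eq_AE eventually_mono[OF ae])
        (auto simp: open_seg_eq seg_split[OF c(3)] seg_commute[of c a])
    also have "\<dots> = emeasure tree_measure (seg c a) + emeasure tree_measure (seg c b - {c})"
      using seg_split_Int[OF c(3)] by (intro plus_emeasure[symmetric]) (auto simp: seg_commute[of c a])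
    also have "emeasure tree_measure (seg c b - {c}) = emeasure tree_measure (seg c b)"
      by (intro emeasure_eq_AE eventually_mono[OF ae]) auto
    also have "emeasure tree_measure (seg c a) + emeasure tree_measure (seg c b) = ennreal (dist a b)"
      using c leg[OF c(1)] leg[OF c(2)] by (simp add: seg_iff[of c a b] dist_commute flip: ennreal_plus)
    finally show ?thesis .
  qed
  have "emeasure (arc_measure (X n)) ((UNIV - skeleton) \<inter> piece n) = 0" for n
  proof -
    \<comment> \<open>Outside the skeleton an arc can only have its two ends.\<close>
    have "(UNIV - skeleton) \<inter> piece n \<subseteq> {\<rho>} \<union> {X n}"
      using piece_subset[of n] open_seg_in_skeleton[of \<rho> "X n"] by (auto simp: open_seg_eq)
    moreover have "{\<rho>} \<union> {X n} \<in> null_sets (arc_measure (X n))"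
      by (intro null_sets.Un null_setsI) (auto simp: arc_measure_singleton)
    moreover have "(UNIV - skeleton) \<inter> piece n \<in> sets (arc_measure (X n))"
      unfolding sets_arc_measure by (intro sets.Int sets.Diff skeleton_borel piece_borel) simp
    ultimately have "(UNIV - skeleton) \<inter> piece n \<in> null_sets (arc_measure (X n))"
      using null_sets_subset by blast
    then show ?thesis by (rule null_setsD1)
  qed
  then have null: "UNIV - skeleton \<in> null_sets tree_measure"
    by (intro null_setsI) (auto simp: emeasure_tree_measure)
  have sp: "space tree_measure = UNIV"
    using sets_eq_imp_space_eq[OF sets_tree_measure] by simp
  have fin: "emeasure tree_measure (seg \<rho> x) < \<infinity>" for x
    using tree_measure_arc[of "seg \<rho> x" x] arc_measure_seg[of \<rho> x] by simp
  have "sigma_finite_measure tree_measure"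
  proof
    show "\<exists>A. countable A \<and> A \<subseteq> sets tree_measure \<and> \<Union>A = space tree_measure \<and>
        (\<forall>a\<in>A. emeasure tree_measure a \<noteq> \<infinity>)"
    proof (intro exI[of _ "insert (UNIV - skeleton) (range (\<lambda>n. seg \<rho> (X n)))"] conjI)
      show "\<Union>(insert (UNIV - skeleton) (range (\<lambda>n. seg \<rho> (X n)))) = space tree_measure"
        using skeleton_subset by (auto simp: sp)
      show "\<forall>a\<in>insert (UNIV - skeleton) (range (\<lambda>n. seg \<rho> (X n))). emeasure tree_measure a \<noteq> \<infinity>"
        using null fin by (auto simp: null_sets_def less_top)
    qed auto
  qed
  then show ?thesis
    using open_seg null by (simp add: is_length_measure_def)
qed

text \<open>Up to a null set the tree is the disjoint union of the pieces, and on each piece a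
  length measure is forced to be the arc measure.\<close>

lemma length_measure_unique:
  assumes M: "is_length_measure (M :: 'a measure)"
  shows "M = tree_measure"
proof (rule measure_eqI)
  show sets: "sets M = sets tree_measure" using M by (simp add: is_length_measure_def)
  fix B assume "B \<in> sets M"
  then have B: "B \<in> sets borel" using sets by simp
  have *: "emeasure L B = (\<Sum>n. emeasure (arc_measure (X n)) (B \<inter> piece n))"
    if L: "is_length_measure L" for L
  proof -
    have setsL: "sets L = sets borel" using L by (simp add: is_length_measure_def)
    have "AE z in L. z \<notin> UNIV - skeleton"
      using L by (intro AE_not_in) (simp add: is_length_measure_def)
    then have "AE z in L. z \<in> (\<Union>n. piece n)"
      unfolding UN_piece using skeleton_subset by (auto elim!: eventually_mono)
    then have "emeasure L B = emeasure L (\<Union>n. B \<inter> piece n)"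
      using B by (intro emeasure_eq_AE) (auto simp: setsL elim!: eventually_mono)
    also have "\<dots> = (\<Sum>n. emeasure L (B \<inter> piece n))"
      using B disjoint_piece
      by (intro suminf_emeasure[symmetric]) (auto simp: disjoint_family_on_def setsL)
    also have "\<dots> = (\<Sum>n. emeasure (arc_measure (X n)) (B \<inter> piece n))"
      using B piece_subset by (intro suminf_cong length_measure_arc[OF L]) auto
    finally show ?thesis .
  qed
  show "emeasure M B = emeasure tree_measure B"
    using *[OF M] *[OF tree_measure_length_measure] by simp
qed

lemma is_length_measure: "is_length_measure (length_measure :: 'a measure)"
  unfolding length_measure_def
  using length_measure_unique tree_measure_length_measure by (metis theI')

end

section \<open>The chain rule for integrals on the line\<close>

text \<open>The positive and negative parts of \<open>f\<close> are densities of finite measures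
  that agree on rays, hence everywhere. So the parts agree almost everywhere, and one of them is
  always 0.\<close>

lemma AE_zero_of_ray_integrals:
  fixes f :: "real \<Rightarrow> real"
  assumes f: "integrable lborel f" and zero: "\<And>s. (LINT x:{s<..}|lborel. f x) = 0"
  shows "AE x in lborel. f x = 0"
proof -
  have [measurable]: "f \<in> borel_measurable borel" using f by auto
  have fp: "integrable lborel (\<lambda>x. max 0 (f x))" and fm: "integrable lborel (\<lambda>x. max 0 (- f x))"
    using f by auto
  define P where "P = density lborel (\<lambda>x. ennreal (max 0 (f x)))"
  define N where "N = density lborel (\<lambda>x. ennreal (max 0 (- f x)))"
  have set_int: "set_integrable lborel {s<..} h" if "integrable lborel h" for s and h :: "real \<Rightarrow> real"
    using that unfolding set_integrable_def by (intro integrable_mult_indicator) auto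
  have em: "emeasure (density lborel (\<lambda>x. ennreal (max 0 (h x)))) {s<..}
      = ennreal (LINT x:{s<..}|lborel. max 0 (h x))"
    if h: "integrable lborel (\<lambda>x. max 0 (h x))" "h \<in> borel_measurable borel" for s and h :: "real \<Rightarrow> real"
  proof -
    have "emeasure (density lborel (\<lambda>x. ennreal (max 0 (h x)))) {s<..}
        = (\<integral>\<^sup>+x. ennreal (indicator {s<..} x *\<^sub>R max 0 (h x)) \<partial>lborel)"
      using h(2) by (subst emeasure_density) (auto intro!: nn_integral_cong split: split_indicator)
    also have "\<dots> = ennreal (LINT x:{s<..}|lborel. max 0 (h x))"
      unfolding set_lebesgue_integral_def using set_int[OF h(1), of s]
      by (intro nn_integral_eq_integral) (auto simp: set_integrable_def)
    finally show ?thesis .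
  qed
  have P: "emeasure P {s<..} = ennreal (LINT x:{s<..}|lborel. max 0 (f x))" for s
    unfolding P_def using fp by (rule em) measurable
  have N: "emeasure N {s<..} = ennreal (LINT x:{s<..}|lborel. max 0 (- f x))" for s
    unfolding N_def using fm by (rule em) measurable
  have "P = N"
  proof (rule measure_eqI_lessThan)
    fix s
    have "(LINT x:{s<..}|lborel. f x) = (LINT x:{s<..}|lborel. max 0 (f x) - max 0 (- f x))"
      by (intro arg_cong2[where f = "set_lebesgue_integral lborel"]) auto
    also have "\<dots> = (LINT x:{s<..}|lborel. max 0 (f x)) - (LINT x:{s<..}|lborel. max 0 (- f x))"
      by (rule set_integral_diff[OF set_int[OF fp] set_int[OF fm]])
    finally show "emeasure P {s<..} = emeasure N {s<..}"
      using zero[of s] unfolding P N by simp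
    show "emeasure P {s<..} < \<infinity>" unfolding P by simp
  qed (auto simp: P_def N_def)
  moreover have "(\<integral>\<^sup>+x. ennreal (max 0 (f x)) \<partial>lborel) \<noteq> \<infinity>"
    using nn_integral_eq_integral[OF fp] by simp
  ultimately have "AE x in lborel. ennreal (max 0 (f x)) = ennreal (max 0 (- f x))"
    unfolding P_def N_def by (subst (asm) finite_density_unique) auto
  then show ?thesis
    by (rule eventually_mono) (auto simp: max_def split: if_splits)
qed

lemma mean_value_segment:
  fixes \<phi> \<phi>' :: "real \<Rightarrow> real"
  assumes "\<And>u. (\<phi> has_real_derivative \<phi>' u) (at u)"
  shows "\<exists>\<xi>\<in>closed_segment a b. \<phi> b - \<phi> a = \<phi>' \<xi> * (b - a)"
proof -
  consider "a = b" | "a < b" | "b < a" by linarith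
  then show ?thesis
  proof cases
    case 2
    then obtain z where "a < z" "z < b" "\<phi> b - \<phi> a = (b - a) * \<phi>' z"
      using MVT2[of a b \<phi> \<phi>'] assms by blast
    then show ?thesis by (intro bexI[of _ z]) (auto simp: closed_segment_eq_real_ivl)
  next
    case 3
    then obtain z where "b < z" "z < a" "\<phi> a - \<phi> b = (a - b) * \<phi>' z"
      using MVT2[of b a \<phi> \<phi>'] assms by blast
    then show ?thesis by (intro bexI[of _ z]) (auto simp: closed_segment_eq_real_ivl algebra_simps)
  qed auto
qed

text \<open>On a short interval the mean value theorem writes the increment of \<open>\<phi> \<circ> F\<close> as
  \<open>\<phi>' (F u)\<close> times the increment of \<open>F\<close>, so the defect of the chain rule is at most
  \<open>\<eta>\<close> times the total variation; no differentiation theorem is needed.\<close>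

lemma chain_rule_integral:
  fixes F G \<phi> \<phi>' :: "real \<Rightarrow> real"
  assumes d: "0 \<le> d" and G: "set_integrable lborel {0..d} G"
    and F: "\<And>t. t \<in> {0..d} \<Longrightarrow> F t = F 0 + (LINT s:{0..t}|lborel. G s)"
    and contF: "continuous_on {0..d} F"
    and \<phi>: "\<And>u. (\<phi> has_real_derivative \<phi>' u) (at u)"
    and cont\<phi>': "continuous_on UNIV \<phi>'"
  shows "set_integrable lborel {0..d} (\<lambda>s. \<phi>' (F s) * G s)"
    and "\<phi> (F d) = \<phi> (F 0) + (LINT s:{0..d}|lborel. \<phi>' (F s) * G s)"
proof -
  define H where "H s = \<phi>' (F s)" for s
  have contH: "continuous_on {0..d} H"
    unfolding H_def by (rule continuous_on_compose2[OF cont\<phi>' contF]) auto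
  then have "bounded (H ` {0..d})"
    by (intro compact_imp_bounded compact_continuous_image) auto
  then obtain B where B: "\<And>s. s \<in> {0..d} \<Longrightarrow> \<bar>H s\<bar> \<le> B"
    unfolding bounded_iff by (metis imageI real_norm_def)
  \<comment> \<open>\<open>F\<close> is controlled on \<open>{0..d}\<close> only, so measurability
    is obtained for the products with the indicator.\<close>
  have measH: "(\<lambda>s. indicator {0..d} s *\<^sub>R H s) \<in> borel_measurable borel"
    by (rule borel_measurable_continuous_on_indicator[OF _ contH]) simp
  have measG: "(\<lambda>s. indicator {0..d} s *\<^sub>R G s) \<in> borel_measurable borel"
    using borel_measurable_integrable[OF G[unfolded set_integrable_def]] by simp
  have HG: "set_integrable lborel {0..d} (\<lambda>s. H s * G s)"
    unfolding set_integrable_def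
  proof (rule Bochner_Integration.integrable_bound)
    show "integrable lborel (\<lambda>s. B * (indicator {0..d} s *\<^sub>R G s))"
      using G unfolding set_integrable_def by (rule integrable_mult_right)
    have "(\<lambda>s. (indicator {0..d} s *\<^sub>R H s) * (indicator {0..d} s *\<^sub>R G s)) \<in> borel_measurable borel"
      by (intro borel_measurable_times measH measG)
    also have "(\<lambda>s. (indicator {0..d} s *\<^sub>R H s) * (indicator {0..d} s *\<^sub>R G s)) =
        (\<lambda>s. indicator {0..d} s *\<^sub>R (H s * G s))"
      by (auto split: split_indicator)
    finally show "(\<lambda>s. indicator {0..d} s *\<^sub>R (H s * G s)) \<in> borel_measurable lborel"
      by simp
    have "\<bar>H s\<bar> * \<bar>G s\<bar> \<le> \<bar>B\<bar> * \<bar>G s\<bar>" if "s \<in> {0..d}" for s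
      using B[OF that] by (intro mult_right_mono) auto
    then show "AE s in lborel. norm (indicator {0..d} s *\<^sub>R (H s * G s)) \<le> norm (B * (indicator {0..d} s *\<^sub>R G s))"
      by (intro AE_I2) (auto simp: abs_mult split: split_indicator)
  qed
  then show "set_integrable lborel {0..d} (\<lambda>s. \<phi>' (F s) * G s)" by (simp add: H_def)
  have absG: "set_integrable lborel {0..d} (\<lambda>s. \<bar>G s\<bar>)"
    using G by (rule set_integrable_abs)
  have sub: "set_integrable lborel S k"
    if "set_integrable lborel {0..d} k" "S \<in> sets borel" "S \<subseteq> {0..d}" for S and k :: "real \<Rightarrow> real"
    using that by (intro set_integrable_subset[OF that(1)]) auto
  have split: "(LINT r:{0..t}|lborel. k r) = (LINT r:{0..s}|lborel. k r) + (LINT r:{s<..t}|lborel. k r)"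
    if k: "set_integrable lborel {0..d} k" and st: "0 \<le> s" "s \<le> t" "t \<le> d" for s t and k :: "real \<Rightarrow> real"
  proof -
    have "{0..t} = {0..s} \<union> {s<..t}" using st by auto
    then show ?thesis
      using st by (simp only:) (intro set_integral_Un sub[OF k]; auto)
  qed
  define D where "D t = \<phi> (F t) - \<phi> (F 0) - (LINT s:{0..t}|lborel. H s * G s)" for t
  define A where "A t = (LINT s:{0..t}|lborel. \<bar>G s\<bar>)" for t
  have D0: "D 0 = 0" and A0: "A 0 = 0"
  proof -
    have "(LINT s:{0..0}|lborel. k s) = 0" for k :: "real \<Rightarrow> real"
      unfolding set_lebesgue_integral_def
      by (intro integral_eq_zero_AE eventually_mono[OF AE_lborel_singleton[of 0]]) auto
    then show "D 0 = 0" "A 0 = 0" by (simp_all add: D_def A_def)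
  qed
  have "\<bar>D d\<bar> \<le> \<eta> * A d" if \<eta>: "\<eta> > 0" for \<eta>
  proof -
    have "uniformly_continuous_on {0..d} H"
      by (intro compact_uniformly_continuous contH) simp
    then obtain \<delta> where \<delta>: "\<delta> > 0" "\<And>u r. u \<in> {0..d} \<Longrightarrow> r \<in> {0..d} \<Longrightarrow> dist r u < \<delta> \<Longrightarrow> dist (H r) (H u) < \<eta>"
      using \<eta> unfolding uniformly_continuous_on_def by metis
    have step: "\<bar>D t - D s\<bar> \<le> \<eta> * (A t - A s)" if st: "0 \<le> s" "s \<le> t" "t \<le> d" "t - s < \<delta>" for s t
    proof -
      have I: "{s<..t} \<in> sets borel" "{s<..t} \<subseteq> {0..d}" using st by auto
      obtain \<xi> where \<xi>: "\<xi> \<in> closed_segment (F s) (F t)" "\<phi> (F t) - \<phi> (F s) = \<phi>' \<xi> * (F t - F s)"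
        using mean_value_segment[OF \<phi>] by metis
      \<comment> \<open>The image of \<open>{s..t}\<close> under \<open>F\<close> is an interval, so
        the intermediate value \<open>\<xi>\<close> is attained at some \<open>u\<close> in
        \<open>{s..t}\<close>; this turns \<open>\<phi>' \<xi>\<close> into \<open>H u\<close>,
        which uniform continuity compares with \<open>H r\<close>.\<close>
      have "convex (F ` {s..t})"
        unfolding is_interval_convex_1[symmetric] is_interval_connected_1
        using st by (intro connected_continuous_image continuous_on_subset[OF contF]) auto
      moreover have "F s \<in> F ` {s..t}" "F t \<in> F ` {s..t}" using st by auto
      ultimately have "closed_segment (F s) (F t) \<subseteq> F ` {s..t}"
        using closed_segment_subset by metis
      then obtain u where u: "u \<in> {s..t}" "\<xi> = F u" using \<xi>(1) by auto
      have "F t - F s = (LINT r:{s<..t}|lborel. G r)"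
        using F[of t] F[of s] split[OF G, of s t] st by simp
      then have "\<phi> (F t) - \<phi> (F s) = (LINT r:{s<..t}|lborel. H u * G r)"
        using \<xi>(2) u(2) by (simp add: H_def)
      moreover have "(LINT r:{0..t}|lborel. H r * G r) - (LINT r:{0..s}|lborel. H r * G r)
          = (LINT r:{s<..t}|lborel. H r * G r)"
        using split[OF HG, of s t] st by simp
      ultimately have "D t - D s = (LINT r:{s<..t}|lborel. H u * G r) - (LINT r:{s<..t}|lborel. H r * G r)"
        by (simp add: D_def)
      also have "\<dots> = (LINT r:{s<..t}|lborel. H u * G r - H r * G r)"
        by (rule set_integral_diff(2)[symmetric]) (auto intro!: sub[OF HG] sub[OF G] I)
      also have "\<bar>\<dots>\<bar> \<le> (LINT r:{s<..t}|lborel. \<eta> * \<bar>G r\<bar>)"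
        unfolding set_lebesgue_integral_def real_norm_def[symmetric]
      proof (rule Bochner_Integration.integral_norm_bound_integral)
        show "integrable lborel (\<lambda>r. indicator {s<..t} r *\<^sub>R (H u * G r - H r * G r))"
          unfolding set_integrable_def[symmetric]
          by (rule set_integral_diff(1)) (auto intro!: sub[OF HG] sub[OF G] I)
        show "integrable lborel (\<lambda>r. indicator {s<..t} r *\<^sub>R (\<eta> * norm (G r)))"
          unfolding set_integrable_def[symmetric] real_norm_def
          by (intro set_integrable_mult_right sub[OF absG] I)
        fix r
        have "\<bar>H u * G r - H r * G r\<bar> \<le> \<eta> * \<bar>G r\<bar>" if r: "r \<in> {s<..t}"
        proof -
          have "dist (H r) (H u) < \<eta>"
            using r u(1) st by (intro \<delta>(2)) (auto simp: dist_real_def)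
          then have "\<bar>H u - H r\<bar> \<le> \<eta>" by (simp add: dist_real_def)
          then show ?thesis
            by (simp add: left_diff_distrib[symmetric] abs_mult mult_right_mono)
        qed
        then show "norm (indicator {s<..t} r *\<^sub>R (H u * G r - H r * G r)) \<le> indicator {s<..t} r *\<^sub>R (\<eta> * norm (G r))"
          by (auto split: split_indicator)
      qed
      also have "\<dots> = \<eta> * (A t - A s)"
        using split[OF absG, of s t] st by (simp add: A_def)
      finally show ?thesis .
    qed
    obtain n :: nat where n: "n > 0" "d / n < \<delta>"
    proof -
      obtain n :: nat where n: "d / \<delta> < n" using reals_Archimedean2 by blast
      then have "n > 0" using d \<delta>(1) by (cases n) (auto simp: divide_less_0_iff)
      then show ?thesis using n \<delta>(1) that[of n] by (auto simp: field_simps)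
    qed
    have "k \<le> n \<Longrightarrow> \<bar>D (k * (d / n))\<bar> \<le> \<eta> * A (k * (d / n))" for k
    proof (induction k)
      case (Suc k)
      have "real (Suc k) * (d / n) \<le> real n * (d / n)"
        using Suc.prems d by (intro mult_right_mono) auto
      then have "\<bar>D (Suc k * (d / n)) - D (k * (d / n))\<bar> \<le> \<eta> * (A (Suc k * (d / n)) - A (k * (d / n)))"
        using n d by (intro step) (auto simp: algebra_simps add_divide_distrib)
      then show ?case using Suc by (simp add: algebra_simps)
    qed (simp add: D0 A0)
    from this[of n] show ?thesis using n(1) by simp
  qed
  note bound = this
  have "A d \<ge> 0"
    unfolding A_def set_lebesgue_integral_def by (intro integral_nonneg_AE AE_I2) auto
  have "\<bar>D d\<bar> \<le> e" if "e > 0" for e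
  proof -
    \<comment> \<open>Dividing by \<open>A d + 1\<close> instead of \<open>A d\<close> covers the
      case of zero variation.\<close>
    have "\<bar>D d\<bar> \<le> e / (A d + 1) * A d"
      using \<open>A d \<ge> 0\<close> that by (intro bound divide_pos_pos) auto
    also have "\<dots> \<le> e" using \<open>A d \<ge> 0\<close> that by (simp add: field_simps)
    finally show ?thesis .
  qed
  then have "D d = 0" by (metis abs_le_zero_iff field_le_epsilon add_0)
  then show "\<phi> (F d) = \<phi> (F 0) + (LINT s:{0..d}|lborel. \<phi>' (F s) * G s)"
    by (simp add: D_def H_def)
qed

section \<open>Gradients\<close>

lemma L2_bound:
  fixes h :: "'b \<Rightarrow> real"
  assumes "integrable M w" "h \<in> borel_measurable M" "\<And>x. (h x)\<^sup>2 \<le> w x"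
  shows "h \<in> L2 M"
proof -
  have "integrable M (\<lambda>x. (h x)\<^sup>2)"
    using assms(2,3) by (intro Bochner_Integration.integrable_bound[OF assms(1)] AE_I2)
      (auto intro: order_trans[OF _ abs_ge_self])
  then show ?thesis using assms(2) by (simp add: L2_def)
qed

lemma L2_add:
  assumes "f \<in> L2 M" "g \<in> L2 M" shows "(\<lambda>x. f x + g x) \<in> L2 M"
proof (rule L2_bound)
  show "integrable M (\<lambda>x. 2 * (f x)\<^sup>2 + 2 * (g x)\<^sup>2)"
    using assms by (auto simp: L2_def)
  show "(f x + g x)\<^sup>2 \<le> 2 * (f x)\<^sup>2 + 2 * (g x)\<^sup>2" for x
    using zero_le_power2[of "f x - g x"] by (simp add: power2_sum power2_diff)
qed (use assms in \<open>auto simp: L2_def\<close>)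

lemma L2_mult_bounded:
  assumes "g \<in> L2 M" "h \<in> borel_measurable M" "\<And>x. \<bar>h x\<bar> \<le> (B::real)"
  shows "(\<lambda>x. h x * g x) \<in> L2 M"
proof (rule L2_bound)
  show "integrable M (\<lambda>x. B\<^sup>2 * (g x)\<^sup>2)"
    using assms by (auto simp: L2_def)
  show "(h x * g x)\<^sup>2 \<le> B\<^sup>2 * (g x)\<^sup>2" for x
  proof -
    have "\<bar>h x\<bar>\<^sup>2 \<le> B\<^sup>2" using assms(3)[of x] by (intro power_mono) auto
    then show ?thesis by (simp add: power_mult_distrib mult_right_mono)
  qed
qed (use assms in \<open>auto simp: L2_def\<close>)

context separable_tree
begin

abbreviation \<Lambda> :: "'a measure" where "\<Lambda> \<equiv> length_measure"

lemma sets_\<Lambda> [simp, measurable_cong]: "sets \<Lambda> = sets borel"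
  using is_length_measure by (simp add: is_length_measure_def)

lemma space_\<Lambda> [simp]: "space \<Lambda> = UNIV"
  using sets_eq_imp_space_eq[OF sets_\<Lambda>] by simp

lemma emeasure_\<Lambda>_seg: "emeasure \<Lambda> (seg a b) = ennreal (dist a b)"
  using length_measure_seg_Diff[OF is_length_measure, of "{}" a b] by simp

lemma measure_\<Lambda>_seg: "measure \<Lambda> (seg a b) = dist a b"
  by (simp add: measure_def emeasure_\<Lambda>_seg)

lemma AE_\<Lambda>_neq: "AE z in \<Lambda>. z \<noteq> p"
  using null_points[OF is_length_measure, of p] by (intro AE_I[where N = "{p}"]) auto

text \<open>The bridge to the line: integrals over arcs from the root become Lebesgue integrals by a
  change of variables.\<close>

lemma density_\<Lambda>_seg: "density \<Lambda> (indicator (seg \<rho> x)) = arc_measure x"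
proof (rule measure_eqI)
  fix B assume "B \<in> sets (density \<Lambda> (indicator (seg \<rho> x)))"
  then have B [measurable]: "B \<in> sets borel" by simp
  have "emeasure (density \<Lambda> (indicator (seg \<rho> x))) B = emeasure \<Lambda> (seg \<rho> x \<inter> B)"
    by (simp add: emeasure_density flip: indicator_inter_arith)
  also have "\<dots> = emeasure (arc_measure x) (seg \<rho> x \<inter> B)"
    by (rule length_measure_arc[OF is_length_measure]) auto
  also have "\<dots> = emeasure (arc_measure x) B"
  proof -
    have "{t \<in> {0..dist \<rho> x}. geo \<rho> x t \<in> seg \<rho> x \<inter> B} = {t \<in> {0..dist \<rho> x}. geo \<rho> x t \<in> B}"
      using geo_in_seg by blast
    then show ?thesis by (simp only: emeasure_arc_measure B sets.Int seg_borel)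
  qed
  finally show "emeasure (density \<Lambda> (indicator (seg \<rho> x))) B = emeasure (arc_measure x) B" .
qed simp

lemma
  assumes [measurable]: "g \<in> borel_measurable borel"
  shows set_integrable_arc: "set_integrable \<Lambda> (seg \<rho> x) (g :: 'a \<Rightarrow> real) \<longleftrightarrow>
      set_integrable lborel {0..dist \<rho> x} (\<lambda>t. g (geo \<rho> x t))"
    and set_integral_arc: "(LINT z:seg \<rho> x|\<Lambda>. g z) = (LINT t:{0..dist \<rho> x}|lborel. g (geo \<rho> x t))"
proof -
  have eq: "density \<Lambda> (\<lambda>z. ennreal (indicator (seg \<rho> x) z)) =
      distr (restrict_space lborel {0..dist \<rho> x}) borel (geo \<rho> x)"
    using density_\<Lambda>_seg[of x] by (simp add: arc_measure_def ennreal_indicator)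
  have m: "g \<in> borel_measurable \<Lambda>" "(indicator (seg \<rho> x) :: 'a \<Rightarrow> real) \<in> borel_measurable \<Lambda>"
    by measurable
  have "set_integrable \<Lambda> (seg \<rho> x) g \<longleftrightarrow> integrable (density \<Lambda> (\<lambda>z. ennreal (indicator (seg \<rho> x) z))) g"
    unfolding set_integrable_def using m by (subst integrable_density) auto
  also have "\<dots> \<longleftrightarrow> set_integrable lborel {0..dist \<rho> x} (\<lambda>t. g (geo \<rho> x t))"
    unfolding eq set_integrable_def
    by (subst integrable_distr_eq[OF measurable_geo assms], subst integrable_restrict_space) auto
  finally show "set_integrable \<Lambda> (seg \<rho> x) g \<longleftrightarrow>
      set_integrable lborel {0..dist \<rho> x} (\<lambda>t. g (geo \<rho> x t))" .
  have "(LINT z:seg \<rho> x|\<Lambda>. g z) = integral\<^sup>L (density \<Lambda> (\<lambda>z. ennreal (indicator (seg \<rho> x) z))) g"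
    unfolding set_lebesgue_integral_def using m by (subst integral_density) auto
  also have "\<dots> = (LINT t:{0..dist \<rho> x}|lborel. g (geo \<rho> x t))"
    unfolding eq set_lebesgue_integral_def
    by (subst integral_distr[OF measurable_geo assms], subst integral_restrict_space) auto
  finally show "(LINT z:seg \<rho> x|\<Lambda>. g z) = (LINT t:{0..dist \<rho> x}|lborel. g (geo \<rho> x t))" .
qed

lemma set_integral_initial_arc:
  assumes "g \<in> borel_measurable borel" "t \<in> {0..dist \<rho> x}"
  shows "(LINT z:seg \<rho> (geo \<rho> x t)|\<Lambda>. g z) = (LINT s:{0..t}|lborel. g (geo \<rho> x s) :: real)"
proof -
  have "(LINT z:seg \<rho> (geo \<rho> x t)|\<Lambda>. g z) = (LINT s:{0..t}|lborel. g (geo \<rho> (geo \<rho> x t) s))"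
    using set_integral_arc[OF assms(1), of "geo \<rho> x t"] by (simp only: dist_geo_left[OF assms(2)])
  also have "\<dots> = (LINT s:{0..t}|lborel. g (geo \<rho> x s))"
    using geo_initial[OF geo_in_seg[OF assms(2)]] dist_geo_left[OF assms(2)]
    by (intro set_lebesgue_integral_cong) auto
  finally show ?thesis .
qed

text \<open>Countably many arcs from the root cover the skeleton, so a property can be tested arc by
  arc.\<close>

lemma AE_\<Lambda>_arcI:
  assumes [measurable]: "Measurable.pred borel P"
    and ae: "\<And>x. AE t in lborel. t \<in> {0..dist \<rho> x} \<longrightarrow> P (geo \<rho> x t)"
  shows "AE z in \<Lambda>. P z"
proof -
  have "AE z in \<Lambda>. z \<in> seg \<rho> (X n) \<longrightarrow> P z" for n
  proof -
    have "AE t in restrict_space lborel {0..dist \<rho> (X n)}. P (geo \<rho> (X n) t)"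
      using ae[of "X n"] by (subst AE_restrict_space_iff) auto
    then have "AE z in arc_measure (X n). P z"
      unfolding arc_measure_def by (subst AE_distr_iff) auto
    then have "AE z in density \<Lambda> (indicator (seg \<rho> (X n))). P z"
      by (simp only: density_\<Lambda>_seg)
    then show ?thesis
      by (subst (asm) AE_density) (auto elim!: eventually_mono)
  qed
  then have "AE z in \<Lambda>. \<forall>n. z \<in> seg \<rho> (X n) \<longrightarrow> P z"
    unfolding AE_all_countable ..
  moreover have "AE z in \<Lambda>. z \<notin> UNIV - skeleton"
    using is_length_measure by (intro AE_not_in) (simp add: is_length_measure_def)
  ultimately show ?thesis
    by eventually_elim (use skeleton_subset in blast)
qed

lemma set_integral_seg_split:
  fixes g :: "'a \<Rightarrow> real"
  assumes c: "c \<in> seg a b" and g: "set_integrable \<Lambda> (seg a b) g"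
  shows "(LINT z:seg a b|\<Lambda>. g z) = (LINT z:seg a c|\<Lambda>. g z) + (LINT z:seg c b|\<Lambda>. g z)"
  unfolding seg_split[OF c]
proof (rule set_integral_Un_AE)
  show "AE z in \<Lambda>. \<not> (z \<in> seg a c \<and> z \<in> seg c b)"
    using AE_\<Lambda>_neq[of c] by (rule eventually_mono) (use seg_split_Int[OF c] in blast)
qed (simp_all add: set_integrable_subset[OF g] seg_sub[OF c] seg_sub2[OF c])

text \<open>The contributions of the common part from the root to the meet cancel.\<close>

lemma tree_integral_eq:
  assumes g: "\<And>x. set_integrable \<Lambda> (seg \<rho> x) g"
  shows "tree_integral \<rho> g x y = (LINT z:seg \<rho> y|\<Lambda>. g z) - (LINT z:seg \<rho> x|\<Lambda>. g z)"
  using set_integral_seg_split[OF meet(2)[of \<rho> x y] g] set_integral_seg_split[OF meet(3)[of \<rho> x y] g]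
  by (simp add: tree_integral_def)

lemma has_gradient_iff:
  "has_gradient \<rho> f g \<longleftrightarrow> g \<in> borel_measurable borel \<and> (\<forall>x. set_integrable \<Lambda> (seg \<rho> x) g) \<and>
     (\<forall>x. f x = f \<rho> + (LINT z:seg \<rho> x|\<Lambda>. g z))"
    (is "_ \<longleftrightarrow> _ \<and> ?I \<and> ?E")
proof -
  have int: "(\<forall>x y. set_integrable \<Lambda> (seg x y) g) \<longleftrightarrow> ?I"
  proof (intro iffI allI)
    fix x y assume I: ?I
    then have "set_integrable \<Lambda> (seg \<rho> x \<union> seg \<rho> y) g"
      by (intro set_integrable_Un) auto
    then show "set_integrable \<Lambda> (seg x y) g"
      by (rule set_integrable_subset) (simp_all add: seg_subset_Un)
  qed blast
  have "(\<forall>x y. f y - f x = tree_integral \<rho> g x y) \<longleftrightarrow> ?E" if I: ?I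
  proof -
    have 0: "(LINT z:seg \<rho> \<rho>|\<Lambda>. g z) = 0"
      unfolding set_lebesgue_integral_def
      by (intro integral_eq_zero_AE eventually_mono[OF AE_\<Lambda>_neq[of \<rho>]]) auto
    show ?thesis
    proof (intro iffI allI)
      fix x assume "\<forall>x y. f y - f x = tree_integral \<rho> g x y"
      then have "f x - f \<rho> = tree_integral \<rho> g \<rho> x" by blast
      then show "f x = f \<rho> + (LINT z:seg \<rho> x|\<Lambda>. g z)"
        using tree_integral_eq[of g \<rho> x] I 0 by simp
    next
      fix x y assume E: ?E
      show "f y - f x = tree_integral \<rho> g x y"
        using tree_integral_eq[of g x y] I E[rule_format, of x] E[rule_format, of y] by simp
    qed
  qed
  then show ?thesis
    unfolding has_gradient_def int by blast
qed

lemma has_gradient_add: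
  assumes "has_gradient \<rho> f g" "has_gradient \<rho> f' g'"
  shows "has_gradient \<rho> (\<lambda>x. f x + f' x) (\<lambda>x. g x + g' x)"
  unfolding has_gradient_iff
proof (intro conjI allI)
  have I: "set_integrable \<Lambda> (seg \<rho> x) g" "set_integrable \<Lambda> (seg \<rho> x) g'" for x
    using assms unfolding has_gradient_iff by blast+
  show "(\<lambda>x. g x + g' x) \<in> borel_measurable borel"
    using assms unfolding has_gradient_iff by (intro borel_measurable_add) blast+
  fix x
  show "set_integrable \<Lambda> (seg \<rho> x) (\<lambda>x. g x + g' x)"
    using I by (rule set_integral_add)
  have "f x = f \<rho> + (LINT z:seg \<rho> x|\<Lambda>. g z)" "f' x = f' \<rho> + (LINT z:seg \<rho> x|\<Lambda>. g' z)"
    using assms unfolding has_gradient_iff by blast+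
  then show "f x + f' x = f \<rho> + f' \<rho> + (LINT z:seg \<rho> x|\<Lambda>. g z + g' z)"
    unfolding set_integral_add(2)[OF I] by simp
qed

lemma has_gradient_cmult:
  assumes "has_gradient \<rho> f g" shows "has_gradient \<rho> (\<lambda>x. c * f x) (\<lambda>x. c * g x)"
  unfolding has_gradient_iff
proof (intro conjI allI)
  show "(\<lambda>x. c * g x) \<in> borel_measurable borel"
    using assms unfolding has_gradient_iff by (intro borel_measurable_times) auto
  fix x
  show "set_integrable \<Lambda> (seg \<rho> x) (\<lambda>x. c * g x)"
    using assms unfolding has_gradient_iff by (intro set_integrable_mult_right) blast
  have "f x = f \<rho> + (LINT z:seg \<rho> x|\<Lambda>. g z)"
    using assms unfolding has_gradient_iff by blast
  then have "c * f x = c * (f \<rho> + (LINT z:seg \<rho> x|\<Lambda>. g z))" by (rule arg_cong)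
  then show "c * f x = c * f \<rho> + (LINT z:seg \<rho> x|\<Lambda>. c * g z)"
    by (simp add: algebra_simps)
qed

lemma has_gradient_const: "has_gradient \<rho> (\<lambda>_. c) (\<lambda>_. 0)"
  unfolding has_gradient_iff by (simp add: set_integrable_def set_lebesgue_integral_def)

text \<open>On the way from the root to \<open>x\<close> the product with \<open>y\<close> grows at
  unit speed up to the meet and is constant from there on.\<close>

lemma has_gradient_gromov: "has_gradient \<rho> (gromov \<rho> y) (indicator (seg \<rho> y))"
  unfolding has_gradient_iff
proof (intro conjI allI)
  show "(indicator (seg \<rho> y) :: 'a \<Rightarrow> real) \<in> borel_measurable borel" by measurable
  fix x
  have eq: "(\<lambda>z. indicator (seg \<rho> x) z *\<^sub>R (indicator (seg \<rho> y) z :: real)) = indicator (seg \<rho> (meet \<rho> y x))"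
    unfolding meet(1)[symmetric] by (auto split: split_indicator)
  show "set_integrable \<Lambda> (seg \<rho> x) (indicator (seg \<rho> y) :: 'a \<Rightarrow> real)"
    unfolding set_integrable_def eq by (intro integrable_real_indicator) (auto simp: emeasure_\<Lambda>_seg)
  show "gromov \<rho> y x = gromov \<rho> y \<rho> + (LINT z:seg \<rho> x|\<Lambda>. indicator (seg \<rho> y) z)"
    unfolding set_lebesgue_integral_def eq
    by (simp add: measure_\<Lambda>_seg meet(5)) (simp add: gromov_def dist_commute)
qed

lemma has_gradient_chain:
  assumes f: "has_gradient \<rho> f g" "continuous_on UNIV f"
    and \<phi>: "\<And>u. (\<phi> has_real_derivative \<phi>' u) (at u)" and \<phi>': "continuous_on UNIV \<phi>'"
  shows "has_gradient \<rho> (\<lambda>x. \<phi> (f x)) (\<lambda>x. \<phi>' (f x) * g x)"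
proof -
  have g: "g \<in> borel_measurable borel" using f unfolding has_gradient_iff by blast
  have "continuous_on UNIV (\<lambda>x. \<phi>' (f x))"
    by (rule continuous_on_compose2[OF \<phi>' f(2)]) simp
  then have m: "(\<lambda>x. \<phi>' (f x) * g x) \<in> borel_measurable borel"
    using borel_measurable_times[OF borel_measurable_continuous_onI g] by blast
  have "set_integrable \<Lambda> (seg \<rho> x) (\<lambda>x. \<phi>' (f x) * g x) \<and>
      \<phi> (f x) = \<phi> (f \<rho>) + (LINT z:seg \<rho> x|\<Lambda>. \<phi>' (f z) * g z)" for x
  proof -
    have G: "set_integrable lborel {0..dist \<rho> x} (\<lambda>t. g (geo \<rho> x t))"
      using f(1) set_integrable_arc[OF g] unfolding has_gradient_iff by blast
    have F: "f (geo \<rho> x t) = f (geo \<rho> x 0) + (LINT s:{0..t}|lborel. g (geo \<rho> x s))"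
      if "t \<in> {0..dist \<rho> x}" for t
      using f(1) set_integral_initial_arc[OF g that] unfolding has_gradient_iff geo_0 by metis
    have contF: "continuous_on {0..dist \<rho> x} (\<lambda>t. f (geo \<rho> x t))"
      by (rule continuous_on_compose2[OF f(2) continuous_on_geo]) simp
    show ?thesis
      using chain_rule_integral[OF zero_le_dist G F contF \<phi> \<phi>']
      unfolding set_integrable_arc[OF m] set_integral_arc[OF m] by simp
  qed
  then show ?thesis using m unfolding has_gradient_iff by blast
qed

text \<open>The difference of two gradients is a gradient of 0, so its integrals over all initial
  parts of an arc vanish. On the line this forces it to vanish almost everywhere.\<close>

lemma has_gradient_unique:
  assumes "has_gradient \<rho> f g" "has_gradient \<rho> f g'"
  shows "AE z in \<Lambda>. g z = g' z"
proof -
  define k where "k z = g z - g' z" for z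
  have "has_gradient \<rho> (\<lambda>x. f x + (-1) * f x) (\<lambda>x. g x + (-1) * g' x)"
    using assms by (intro has_gradient_add has_gradient_cmult)
  then have k0: "has_gradient \<rho> (\<lambda>_. 0) k" by (simp add: k_def[abs_def])
  then have k: "k \<in> borel_measurable borel" unfolding has_gradient_iff by blast
  have "AE z in \<Lambda>. k z = 0"
  proof (rule AE_\<Lambda>_arcI)
    show "Measurable.pred borel (\<lambda>z. k z = 0)" using k by measurable
    fix x
    define d where "d = dist \<rho> x"
    define h where "h t = indicator {0..d} t *\<^sub>R k (geo \<rho> x t)" for t :: real
    have h: "integrable lborel h"
      using k0 set_integrable_arc[OF k, of x] unfolding has_gradient_iff set_integrable_def h_def d_def by blast
    have I0: "(LINT s:{0..t}|lborel. k (geo \<rho> x s)) = 0" if "t \<in> {0..d}" for t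
      using k0 set_integral_initial_arc[OF k, of t x] that unfolding has_gradient_iff d_def by simp
    have low: "(LINT t:{..s}|lborel. h t) = 0" for s
    proof (cases "s < 0")
      case True
      then have "(LINT t:{..s}|lborel. h t) = (LINT t:{..s}|lborel. 0)"
        by (intro set_lebesgue_integral_cong) (auto simp: h_def)
      then show ?thesis by simp
    next
      case False
      then have "(LINT t:{..s}|lborel. h t) = (LINT t:{0..min s d}|lborel. k (geo \<rho> x t))"
        unfolding set_lebesgue_integral_def
        by (intro Bochner_Integration.integral_cong) (auto simp: h_def split: split_indicator)
      then show ?thesis using I0[of "min s d"] False by (simp add: d_def)
    qed
    have set_int: "set_integrable lborel S h" if "S \<in> sets borel" for S
      using that h unfolding set_integrable_def by (intro integrable_mult_indicator) auto
    \<comment> \<open>Lower rays contribute 0, so all upper rays carry the same integral, and the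
      one beyond \<open>d\<close> carries 0.\<close>
    have "(LINT t:{s<..}|lborel. h t) = (LINT t|lborel. h t)" for s
    proof -
      have "(LINT t|lborel. h t) = (LINT t:{..s} \<union> {s<..}|lborel. h t)"
        unfolding set_lebesgue_integral_def
        by (intro Bochner_Integration.integral_cong) (auto split: split_indicator)
      also have "\<dots> = (LINT t:{..s}|lborel. h t) + (LINT t:{s<..}|lborel. h t)"
        by (intro set_integral_Un set_int) auto
      finally show ?thesis using low[of s] by simp
    qed
    moreover have "(LINT t:{d<..}|lborel. h t) = (LINT t:{d<..}|lborel. 0)"
      by (intro set_lebesgue_integral_cong) (auto simp: h_def)
    ultimately have "(LINT t:{s<..}|lborel. h t) = 0" for s
      by simp
    then have "AE t in lborel. h t = 0"
      using h by (intro AE_zero_of_ray_integrals)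
    then show "AE t in lborel. t \<in> {0..dist \<rho> x} \<longrightarrow> k (geo \<rho> x t) = 0"
      by (rule eventually_mono) (auto simp: h_def d_def)
  qed
  then show ?thesis by (rule eventually_mono) (simp add: k_def)
qed

end

section \<open>The form space and its closure properties\<close>

context separable_tree
begin

text \<open>Arcs have finite length, so \<open>1 + (g z)\<^sup>2\<close> is an integrable bound
  there.\<close>

lemma set_integrable_L2:
  assumes "g \<in> L2 \<Lambda>"
  shows "set_integrable \<Lambda> (seg a b) g" "set_integrable \<Lambda> (seg a b) (\<lambda>z. (g z)\<^sup>2)"
proof -
  have g: "g \<in> borel_measurable \<Lambda>" "integrable \<Lambda> (\<lambda>z. (g z)\<^sup>2)"
    using assms by (auto simp: L2_def)
  show sq: "set_integrable \<Lambda> (seg a b) (\<lambda>z. (g z)\<^sup>2)"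
    unfolding set_integrable_def using g(2) by (intro integrable_mult_indicator) auto
  have "set_integrable \<Lambda> (seg a b) (\<lambda>z. 1 + (g z)\<^sup>2)"
    using sq by (intro set_integral_add) (auto simp: set_integrable_def emeasure_\<Lambda>_seg)
  then show "set_integrable \<Lambda> (seg a b) g"
  proof (rule set_integrable_bound)
    show "set_borel_measurable \<Lambda> (seg a b) g"
      unfolding set_borel_measurable_def using g(1) by (intro borel_measurable_scaleR) auto
    have "\<bar>t\<bar> \<le> 1 + t\<^sup>2" for t :: real
      using zero_le_power2[of "\<bar>t\<bar> - 1"] by (simp add: power2_diff)
    then show "AE z in \<Lambda>. z \<in> seg a b \<longrightarrow> norm (g z) \<le> norm (1 + (g z)\<^sup>2)"
      by (intro AE_I2) (auto intro: order_trans[OF _ abs_ge_self])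
  qed
qed

text \<open>Young's inequality, applied pointwise to \<open>g\<close>. With \<open>\<eta>\<close>
  left free it replaces the Cauchy--Schwarz inequality, and both terms add up over disjoint
  arcs.\<close>

lemma gradient_arc_bound:
  assumes f: "has_gradient \<rho> f g" and g: "g \<in> L2 \<Lambda>" and \<eta>: "\<eta> > 0"
  shows "\<bar>f x - f y\<bar> \<le> dist x y / (2 * \<eta>) + \<eta> / 2 * (LINT z:seg x y|\<Lambda>. (g z)\<^sup>2)"
proof -
  define c where "c = meet \<rho> x y"
  have c: "c \<in> seg x y" using meet(4) by (simp add: c_def)
  have abs: "set_integrable \<Lambda> (seg a b) (\<lambda>z. \<bar>g z\<bar>)" for a b
    using set_integrable_L2(1)[OF g] by (rule set_integrable_abs)
  have le: "\<bar>LINT z:seg a b|\<Lambda>. g z\<bar> \<le> (LINT z:seg a b|\<Lambda>. \<bar>g z\<bar>)" for a b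
    using integral_norm_bound[of \<Lambda> "\<lambda>z. indicator (seg a b) z *\<^sub>R g z"]
    by (simp add: set_lebesgue_integral_def abs_mult)
  have "f y - f x = - (LINT z:seg c x|\<Lambda>. g z) + (LINT z:seg c y|\<Lambda>. g z)"
    using f by (simp add: has_gradient_def tree_integral_def c_def)
  then have "\<bar>f x - f y\<bar> \<le> (LINT z:seg x c|\<Lambda>. \<bar>g z\<bar>) + (LINT z:seg c y|\<Lambda>. \<bar>g z\<bar>)"
    using le[of c x] le[of c y] by (simp add: seg_commute[of x c])
  also have "\<dots> = (LINT z:seg x y|\<Lambda>. \<bar>g z\<bar>)"
    using set_integral_seg_split[OF c abs] by simp
  also have "\<dots> \<le> (LINT z:seg x y|\<Lambda>. 1 / (2 * \<eta>) + \<eta> / 2 * (g z)\<^sup>2)"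
  proof (rule set_integral_mono)
    show "set_integrable \<Lambda> (seg x y) (\<lambda>z. 1 / (2 * \<eta>) + \<eta> / 2 * (g z)\<^sup>2)"
      using set_integrable_L2(2)[OF g]
      by (intro set_integral_add set_integrable_mult_right) (auto simp: set_integrable_def emeasure_\<Lambda>_seg)
    fix z
    have "0 \<le> (\<eta> * \<bar>g z\<bar> - 1)\<^sup>2 / (2 * \<eta>)" using \<eta> by simp
    then show "\<bar>g z\<bar> \<le> 1 / (2 * \<eta>) + \<eta> / 2 * (g z)\<^sup>2"
      using \<eta> by (simp add: power2_diff field_simps power2_eq_square)
  qed (rule abs)
  also have "\<dots> = (LINT z:seg x y|\<Lambda>. 1 / (2 * \<eta>)) + (LINT z:seg x y|\<Lambda>. \<eta> / 2 * (g z)\<^sup>2)"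
    using set_integrable_L2(2)[OF g]
    by (intro set_integral_add set_integrable_mult_right) (auto simp: set_integrable_def emeasure_\<Lambda>_seg)
  also have "(LINT z:seg x y|\<Lambda>. 1 / (2 * \<eta>)) = dist x y / (2 * \<eta>)"
    by (simp add: set_lebesgue_integral_def measure_\<Lambda>_seg)
  finally show ?thesis by simp
qed

lemma gradient_L2_loc_abs_cont:
  assumes f: "has_gradient \<rho> f g" and g: "g \<in> L2 \<Lambda>"
  shows "f \<in> loc_abs_cont"
proof -
  define Q where "Q = (LINT z|\<Lambda>. (g z)\<^sup>2)"
  have Q: "Q \<ge> 0" by (simp add: Q_def)
  have *: "(\<Sum>i<n. \<bar>f (x i) - f (y i)\<bar>) < \<epsilon>"
    if \<epsilon>: "\<epsilon> > 0" and disj: "disjoint_family_on (\<lambda>i. seg (x i) (y i)) {..<n}"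
      and small: "(\<Sum>i<n. dist (x i) (y i)) < \<epsilon>\<^sup>2 / (Q + 1)" for \<epsilon> and n :: nat and x y :: "nat \<Rightarrow> 'a"
  proof -
    \<comment> \<open>With total length below \<open>\<epsilon>\<^sup>2 / (Q + 1)\<close>, this
      \<open>\<eta>\<close> makes the length term less than \<open>\<epsilon> / 2\<close> and the
      energy term at most \<open>\<epsilon> / 2\<close>. The summand 1 covers
      \<open>Q = 0\<close>.\<close>
    define \<eta> where "\<eta> = \<epsilon> / (Q + 1)"
    have \<eta>: "\<eta> > 0" using \<epsilon> Q by (simp add: \<eta>_def)
    have sq: "set_integrable \<Lambda> (seg a b) (\<lambda>z. (g z)\<^sup>2)" for a b
      by (rule set_integrable_L2(2)[OF g])
    have "(\<Sum>i<n. LINT z:seg (x i) (y i)|\<Lambda>. (g z)\<^sup>2) = (LINT z:(\<Union>i\<in>{..<n}. seg (x i) (y i))|\<Lambda>. (g z)\<^sup>2)"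
      using disj sq by (intro set_integral_finite_Union[symmetric]) auto
    also have "\<dots> \<le> Q"
      unfolding Q_def set_lebesgue_integral_def
    proof (rule integral_mono)
      show "integrable \<Lambda> (\<lambda>z. (g z)\<^sup>2)" using g by (simp add: L2_def)
      then show "integrable \<Lambda> (\<lambda>z. indicator (\<Union>i<n. seg (x i) (y i)) z *\<^sub>R (g z)\<^sup>2)"
        by (intro integrable_mult_indicator) auto
    qed (auto split: split_indicator)
    finally have Qn: "(\<Sum>i<n. LINT z:seg (x i) (y i)|\<Lambda>. (g z)\<^sup>2) \<le> Q" .
    have "(\<Sum>i<n. \<bar>f (x i) - f (y i)\<bar>) \<le>
        (\<Sum>i<n. dist (x i) (y i) / (2 * \<eta>) + \<eta> / 2 * (LINT z:seg (x i) (y i)|\<Lambda>. (g z)\<^sup>2))"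
      by (intro sum_mono gradient_arc_bound f g \<eta>)
    also have "\<dots> = (\<Sum>i<n. dist (x i) (y i)) / (2 * \<eta>) + \<eta> / 2 * (\<Sum>i<n. LINT z:seg (x i) (y i)|\<Lambda>. (g z)\<^sup>2)"
      by (simp add: sum.distrib sum_divide_distrib sum_distrib_left)
    also have "\<dots> < (\<epsilon>\<^sup>2 / (Q + 1)) / (2 * \<eta>) + \<eta> / 2 * Q"
      using small Qn \<eta> by (intro add_less_le_mono divide_strict_right_mono mult_left_mono) auto
    also have "(\<epsilon>\<^sup>2 / (Q + 1)) / (2 * \<eta>) = \<epsilon> / 2"
      using \<epsilon> Q by (simp add: \<eta>_def power2_eq_square)
    also have "\<eta> / 2 * Q \<le> \<epsilon> / 2"
      using \<epsilon> Q by (simp add: \<eta>_def field_simps)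
    finally show ?thesis by simp
  qed
  \<comment> \<open>Continuity is the estimate for a single arc.\<close>
  have "continuous_on UNIV f"
    unfolding continuous_on_iff
  proof (intro ballI allI impI)
    fix x :: 'a and e :: real assume e: "e > 0"
    have "dist (f y) (f x) < e" if "dist y x < e\<^sup>2 / (Q + 1)" for y
      using *[OF e, of "\<lambda>_. y" "\<lambda>_. x" 1] that by (simp add: disjoint_family_on_def dist_real_def)
    moreover have "e\<^sup>2 / (Q + 1) > 0" using e Q by simp
    ultimately show "\<exists>d>0. \<forall>y\<in>UNIV. dist y x < d \<longrightarrow> dist (f y) (f x) < e" by blast
  qed
  moreover have "\<exists>\<delta>>0. \<forall>(n::nat) x y. (\<forall>i<n. seg (x i) (y i) \<subseteq> S) \<and>
      disjoint_family_on (\<lambda>i. seg (x i) (y i)) {..<n} \<and> (\<Sum>i<n. dist (x i) (y i)) < \<delta> \<longrightarrow>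
      (\<Sum>i<n. \<bar>f (x i) - f (y i)\<bar>) < \<epsilon>" if "\<epsilon> > 0" for \<epsilon> and S :: "'a set"
    using *[OF that] that Q by (intro exI[of _ "\<epsilon>\<^sup>2 / (Q + 1)"]) simp
  ultimately show ?thesis by (simp add: loc_abs_cont_def)
qed

text \<open>Any gradient may stand in for the chosen one, since the two differ on a null set
  only.\<close>

lemma form_spaceI:
  assumes f: "has_gradient \<rho> f g" and g: "g \<in> L2 \<Lambda>"
  shows "f \<in> form_space \<rho>" "AE z in \<Lambda>. grad \<rho> f z = g z"
proof -
  have grad: "has_gradient \<rho> f (grad \<rho> f)"
    unfolding grad_def by (rule someI[where P = "has_gradient \<rho> f", OF f])
  show ae: "AE z in \<Lambda>. grad \<rho> f z = g z"
    by (rule has_gradient_unique[OF grad f])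
  have m: "grad \<rho> f \<in> borel_measurable \<Lambda>" "g \<in> borel_measurable \<Lambda>"
    using grad f unfolding has_gradient_iff measurable_cong_sets[OF sets_\<Lambda> refl] by blast+
  have "integrable \<Lambda> (\<lambda>z. (grad \<rho> f z)\<^sup>2) \<longleftrightarrow> integrable \<Lambda> (\<lambda>z. (g z)\<^sup>2)"
    using m ae by (intro integrable_cong_AE) (auto elim!: eventually_mono)
  then show "f \<in> form_space \<rho>"
    using grad m g gradient_L2_loc_abs_cont[OF f g] by (simp add: form_space_def L2_def)
qed

lemma form_spaceD:
  assumes "f \<in> form_space \<rho>"
  shows "has_gradient \<rho> f (grad \<rho> f)" "grad \<rho> f \<in> L2 \<Lambda>" "continuous_on UNIV f"
  using assms by (auto simp: form_space_def loc_abs_cont_def)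

lemma form_space_add:
  assumes "f \<in> form_space \<rho>" "g \<in> form_space \<rho>" shows "(\<lambda>x. f x + g x) \<in> form_space \<rho>"
  using assms form_spaceI(1)[OF has_gradient_add L2_add] form_spaceD by blast

lemma form_space_cmult:
  assumes "f \<in> form_space \<rho>" shows "(\<lambda>x. c * f x) \<in> form_space \<rho>"
  by (rule form_spaceI(1)[OF has_gradient_cmult L2_mult_bounded[where B = "\<bar>c\<bar>"]])
    (use form_spaceD[OF assms] in auto)

lemma form_space_const: "(\<lambda>_. c) \<in> form_space \<rho>"
  by (rule form_spaceI[OF has_gradient_const]) (simp add: L2_def)

lemma form_space_gromov: "gromov \<rho> y \<in> form_space \<rho>"
  by (rule form_spaceI[OF has_gradient_gromov])
    (simp add: L2_def power2_eq_square emeasure_\<Lambda>_seg flip: indicator_inter_arith)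

text \<open>The derivative is bounded along the values of \<open>f\<close> only, so that squares of
  bounded functions are included.\<close>

lemma form_space_chain:
  assumes f: "f \<in> form_space \<rho>"
    and \<phi>: "\<And>u. (\<phi> has_real_derivative \<phi>' u) (at u)" "continuous_on UNIV \<phi>'"
    and B: "\<And>x. \<bar>\<phi>' (f x)\<bar> \<le> B"
  shows "(\<lambda>x. \<phi> (f x)) \<in> form_space \<rho>"
    and "AE z in \<Lambda>. grad \<rho> (\<lambda>x. \<phi> (f x)) z = \<phi>' (f z) * grad \<rho> f z"
proof -
  note D = form_spaceD[OF f]
  have "continuous_on UNIV (\<lambda>x. \<phi>' (f x))"
    by (rule continuous_on_compose2[OF \<phi>(2) D(3)]) simp
  then have "(\<lambda>x. \<phi>' (f x)) \<in> borel_measurable borel"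
    by (rule borel_measurable_continuous_onI)
  then have "(\<lambda>x. \<phi>' (f x)) \<in> borel_measurable \<Lambda>" by measurable
  then have "(\<lambda>z. \<phi>' (f z) * grad \<rho> f z) \<in> L2 \<Lambda>"
    using B D(2) by (intro L2_mult_bounded)
  then show "(\<lambda>x. \<phi> (f x)) \<in> form_space \<rho>"
    and "AE z in \<Lambda>. grad \<rho> (\<lambda>x. \<phi> (f x)) z = \<phi>' (f z) * grad \<rho> f z"
    using form_spaceI[OF has_gradient_chain[OF D(1,3) \<phi>]] by blast+
qed

text \<open>Polarization: products reduce to squares, which the chain rule handles. Boundedness
  keeps the derivative \<open>2 * u\<close> bounded on the values.\<close>

lemma form_space_mult:
  assumes f: "f \<in> form_space \<rho>" "\<And>x. \<bar>f x\<bar> \<le> A" and g: "g \<in> form_space \<rho>" "\<And>x. \<bar>g x\<bar> \<le> B"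
  shows "(\<lambda>x. f x * g x) \<in> form_space \<rho>"
proof -
  have sq: "(\<lambda>x. (h x)\<^sup>2) \<in> form_space \<rho>" if h: "h \<in> form_space \<rho>" "\<And>x. \<bar>h x\<bar> \<le> C" for h C
  proof (rule form_space_chain[OF h(1), where \<phi>' = "\<lambda>u. 2 * u" and B = "2 * C"])
    show "((\<lambda>u. u\<^sup>2) has_real_derivative 2 * u) (at u)" for u :: real
      by (auto intro!: derivative_eq_intros)
    show "continuous_on UNIV (\<lambda>u::real. 2 * u)" by (intro continuous_intros)
    show "\<bar>2 * h x\<bar> \<le> 2 * C" for x using h(2)[of x] by (simp add: abs_mult)
  qed
  have "\<bar>f x + g x\<bar> \<le> A + B" for x
    using f(2)[of x] g(2)[of x] by linarith
  then have "(\<lambda>x. (f x + g x)\<^sup>2) \<in> form_space \<rho>"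
    by (intro sq[of _ "A + B"] form_space_add f g)
  then have "(\<lambda>x. (1 / 2) * ((f x + g x)\<^sup>2 + ((-1) * (f x)\<^sup>2 + (-1) * (g x)\<^sup>2))) \<in> form_space \<rho>"
    using sq[OF f] sq[OF g] by (intro form_space_cmult form_space_add)
  also have "(\<lambda>x. (1 / 2) * ((f x + g x)\<^sup>2 + ((-1) * (f x)\<^sup>2 + (-1) * (g x)\<^sup>2))) = (\<lambda>x. f x * g x)"
    by (simp add: power2_sum)
  finally show ?thesis .
qed

end

text \<open>A continuous trapezoid, 1 on \<open>{-e..e}\<close> and 0 beyond \<open>2 * e\<close>,
  which serves as the derivative of the truncation.\<close>

definition cutoff :: "real \<Rightarrow> real \<Rightarrow> real" where
  "cutoff e t = max 0 (min 1 (2 - \<bar>t\<bar> / e))"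

lemma cutoff_props:
  assumes "e > 0"
  shows "0 \<le> cutoff e t" "cutoff e t \<le> 1" "\<bar>t\<bar> \<le> e \<Longrightarrow> cutoff e t = 1" "2 * e \<le> \<bar>t\<bar> \<Longrightarrow> cutoff e t = 0"
    "continuous_on UNIV (cutoff e)"
proof -
  show "0 \<le> cutoff e t" "cutoff e t \<le> 1" by (auto simp: cutoff_def)
  show "\<bar>t\<bar> \<le> e \<Longrightarrow> cutoff e t = 1" "2 * e \<le> \<bar>t\<bar> \<Longrightarrow> cutoff e t = 0"
    using assms by (auto simp: cutoff_def field_simps max_def min_def)
  show "continuous_on UNIV (cutoff e)"
    unfolding cutoff_def using assms by (intro continuous_intros) auto
qed

lemma cutoff_tendsto:
  "(\<lambda>n. cutoff (1 / real (Suc n)) t) \<longlonglongrightarrow> (if t = 0 then 1 else 0)"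
proof (cases "t = 0")
  case False
  have "(\<lambda>n. 2 * (1 / real (Suc n))) \<longlonglongrightarrow> 2 * 0"
    by (intro tendsto_mult tendsto_const LIMSEQ_Suc[OF lim_1_over_n])
  then have "\<forall>\<^sub>F n in sequentially. 2 * (1 / real (Suc n)) < \<bar>t\<bar>"
    using False by (intro order_tendstoD(2)) auto
  then have "\<forall>\<^sub>F n in sequentially. cutoff (1 / real (Suc n)) t = 0"
    by (rule eventually_mono) (auto intro: cutoff_props(4))
  then show ?thesis using False by (simp add: tendsto_eventually)
qed (simp add: cutoff_def)

text \<open>\<open>\<psi>\<close> is the antiderivative of the trapezoid that vanishes at 0. Being
  the identity near 0 makes \<open>f - \<psi> f\<close> vanish where \<open>f\<close> is small; the
  bound \<open>2 * e\<close> gives convergence to 0, and the bound by \<open>\<bar>t\<bar>\<close>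
  gives domination.\<close>

lemma truncation_exists:
  assumes e: "e > 0"
  shows "\<exists>\<psi>. (\<forall>u. (\<psi> has_real_derivative cutoff e u) (at u)) \<and> (\<forall>t. \<bar>t\<bar> \<le> e \<longrightarrow> \<psi> t = t) \<and>
    (\<forall>t. \<bar>\<psi> t\<bar> \<le> \<bar>t\<bar> \<and> \<bar>\<psi> t\<bar> \<le> 2 * e)"
proof -
  note c = cutoff_props[OF e]
  have "isCont (cutoff e) x" for x
    using c(5) by (simp add: continuous_on_eq_continuous_at)
  \<comment> \<open>Infinite limits in the interval yield an antiderivative on the whole
    line.\<close>
  then obtain F where F: "\<And>x. (F has_vector_derivative cutoff e x) (at x)"
    using einterval_antiderivative[of "-\<infinity>" \<infinity> "cutoff e"] by auto
  define \<psi> where "\<psi> t = F t - F 0" for t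
  have der: "(\<psi> has_real_derivative cutoff e u) (at u)" for u
    unfolding \<psi>_def using F[of u]
    by (auto simp: has_real_derivative_iff_has_vector_derivative intro!: derivative_eq_intros)
  have mv: "\<exists>\<xi>\<in>closed_segment a b. \<psi> b - \<psi> a = cutoff e \<xi> * (b - a)" for a b
    by (rule mean_value_segment[OF der])
  have mv0: "\<exists>\<xi>. \<bar>\<xi>\<bar> \<le> \<bar>t\<bar> \<and> \<psi> t = cutoff e \<xi> * t" for t
    using mv[of 0 t] by (force simp: \<psi>_def closed_segment_eq_real_ivl split: if_splits)
  have id: "\<psi> t = t" if "\<bar>t\<bar> \<le> e" for t
    using mv0[of t] c(3) that by force
  have le: "\<bar>\<psi> t\<bar> \<le> \<bar>t\<bar>" for t
  proof -
    obtain \<xi> where \<xi>: "\<psi> t = cutoff e \<xi> * t" using mv0 by blast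
    show ?thesis
      using c(1,2)[of \<xi>] by (auto simp: \<xi> abs_mult intro!: mult_left_le_one_le)
  qed
  have "\<bar>\<psi> t\<bar> \<le> 2 * e" for t
  proof (cases "\<bar>t\<bar> \<le> 2 * e")
    case True
    then show ?thesis using le[of t] by linarith
  next
    case False
    \<comment> \<open>The point where the plateau on the side of \<open>t\<close> begins; between
      \<open>s\<close> and \<open>t\<close> the derivative is 0.\<close>
    define s where "s = (if t > 0 then 2 * e else - 2 * e)"
    obtain \<xi> where \<xi>: "\<xi> \<in> closed_segment s t" "\<psi> t - \<psi> s = cutoff e \<xi> * (t - s)"
      using mv by blast
    have "2 * e \<le> \<bar>\<xi>\<bar>"
      using \<xi>(1) False e by (auto simp: s_def closed_segment_eq_real_ivl split: if_splits)
    then have "\<psi> t = \<psi> s" using \<xi>(2) c(4) by simp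
    then show ?thesis using le[of s] e by (auto simp: s_def split: if_splits)
  qed
  then show ?thesis using der id le by blast
qed

section \<open>Density of compactly supported functions\<close>

lemma C_0_subset_C_inf: "C_0 \<subseteq> C_inf"
proof
  fix f :: "'a::metric_space \<Rightarrow> real" assume f: "f \<in> C_0"
  have "\<bar>f x\<bar> \<le> \<epsilon>" if "x \<notin> closure {x. f x \<noteq> 0}" "\<epsilon> > 0" for x \<epsilon>
  proof -
    have "f x = 0" using that(1) closure_subset[of "{x. f x \<noteq> 0}"] by blast
    then show ?thesis using that(2) by simp
  qed
  then show "f \<in> C_inf" using f by (auto simp: C_0_def C_inf_def)
qed

lemma C_0_bounded:
  assumes "f \<in> C_0" shows "\<exists>B. \<forall>x. \<bar>f x\<bar> \<le> B"
proof -
  define K where "K = closure {x. f x \<noteq> 0}"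
  have K: "compact K" and cont: "continuous_on UNIV f"
    using assms by (simp_all add: C_0_def K_def)
  have "bounded (f ` K)"
    by (rule compact_imp_bounded[OF compact_continuous_image[OF continuous_on_subset[OF cont subset_UNIV] K]])
  then obtain B where B: "\<And>x. x \<in> K \<Longrightarrow> \<bar>f x\<bar> \<le> B"
    unfolding bounded_iff by (metis imageI real_norm_def)
  have "\<bar>f x\<bar> \<le> max B 0" for x
  proof (cases "f x = 0")
    case False
    then have "x \<in> K" using closure_subset[of "{x. f x \<noteq> 0}"] by (auto simp: K_def)
    then show ?thesis using B by (simp add: le_max_iff_disj)
  qed simp
  then show ?thesis by blast
qed

lemma C_0_L2:
  assumes \<nu>: "radon_measure \<nu>" and f: "f \<in> C_0"
  shows "f \<in> L2 \<nu>"
proof -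
  define K where "K = closure {x. f x \<noteq> 0}"
  have sets: "sets \<nu> = sets borel" using \<nu> by (simp add: radon_measure_def)
  have K: "compact K" "K \<in> sets \<nu>" "emeasure \<nu> K < \<infinity>"
    using f \<nu> sets by (auto simp: C_0_def K_def radon_measure_def)
  obtain B where B: "\<And>x. \<bar>f x\<bar> \<le> B" using C_0_bounded[OF f] by blast
  show ?thesis
  proof (rule L2_bound)
    show "integrable \<nu> (\<lambda>x. B\<^sup>2 * indicator K x)"
      using K by (intro integrable_mult_right integrable_real_indicator)
    show "f \<in> borel_measurable \<nu>"
      unfolding measurable_cong_sets[OF sets refl]
      using f by (intro borel_measurable_continuous_onI) (simp add: C_0_def)
    show "(f x)\<^sup>2 \<le> B\<^sup>2 * indicator K x" for x
      using B[of x] power_mono[OF B[of x], of 2] closure_subset[of "{x. f x \<noteq> 0}"]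
      by (cases "f x = 0") (auto simp: K_def split: split_indicator)
  qed
qed

lemma C_0_mult:
  assumes f: "f \<in> C_0" and h: "continuous_on UNIV h"
  shows "(\<lambda>x. h x * f x) \<in> C_0"
proof -
  have "closure {x. h x * f x \<noteq> 0} \<subseteq> closure {x. f x \<noteq> 0}"
    by (intro closure_mono) auto
  then have "compact (closure {x. h x * f x \<noteq> 0})"
    using f compact_Int_closed[of "closure {x. f x \<noteq> 0}" "closure {x. h x * f x \<noteq> 0}"]
    by (simp add: C_0_def Int_absorb1)
  moreover have "continuous_on UNIV (\<lambda>x. h x * f x)"
    using f h by (intro continuous_intros) (auto simp: C_0_def)
  ultimately show ?thesis by (simp add: C_0_def)
qed

context separable_tree
begin

text \<open>A function in \<open>C_0\<close> is bounded with support of finite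
  \<open>\<nu>\<close>-measure, so membership in the domain is decided by its gradient.\<close>

lemma form_domain_C_0:
  assumes "radon_measure \<nu>"
  shows "form_domain \<rho> \<nu> \<inter> C_0 = form_space \<rho> \<inter> C_0"
  using C_0_subset_C_inf C_0_L2[OF assms] by (auto simp: form_domain_def)

text \<open>Passing to the limit in \<open>\<psi>\<^sub>n \<circ> f\<close> shows that \<open>1\<^bsub>{f = 0}\<^esub> \<nabla>f\<close> is a gradient of the
  zero function.\<close>

lemma grad_zero_set:
  assumes f: "f \<in> form_space \<rho>"
  shows "AE z in \<Lambda>. f z = 0 \<longrightarrow> grad \<rho> f z = 0"
proof -
  note D = form_spaceD[OF f]
  define c where "c n = cutoff (1 / real (Suc n))" for n
  have c: "0 \<le> c n t" "c n t \<le> 1" "continuous_on UNIV (c n)" for n t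
    using cutoff_props[of "1 / real (Suc n)"] by (auto simp: c_def)
  have "\<forall>n. \<exists>\<psi>. (\<forall>u. (\<psi> has_real_derivative c n u) (at u)) \<and> (\<forall>t. \<bar>\<psi> t\<bar> \<le> 2 * (1 / real (Suc n)))"
    unfolding c_def using truncation_exists by (metis of_nat_0_less_iff zero_less_Suc zero_less_divide_1_iff)
  then obtain \<psi> where \<psi>: "\<And>n u. (\<psi> n has_real_derivative c n u) (at u)"
      "\<And>n t. \<bar>\<psi> n t\<bar> \<le> 2 * (1 / real (Suc n))"
    by metis
  have lim: "(\<lambda>n. 2 * (1 / real (Suc n))) \<longlonglongrightarrow> 2 * 0"
    by (intro tendsto_mult tendsto_const LIMSEQ_Suc[OF lim_1_over_n])
  have \<psi>0: "(\<lambda>n. \<psi> n t) \<longlonglongrightarrow> 0" for t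
  proof (rule Lim_null_comparison)
    show "\<forall>\<^sub>F n in sequentially. norm (\<psi> n t) \<le> 2 * (1 / real (Suc n))"
      using \<psi>(2) by (simp only: real_norm_def eventually_True)
  qed (use lim in simp)
  define h where "h z = indicator {z. f z = 0} z * grad \<rho> f z" for z
  have [measurable]: "f \<in> borel_measurable borel" "grad \<rho> f \<in> borel_measurable borel"
    using D by (auto intro: borel_measurable_continuous_onI simp: has_gradient_def)
  have h [measurable]: "h \<in> borel_measurable borel"
    unfolding h_def by measurable
  have cm: "(\<lambda>z. c n (f z) * grad \<rho> f z) \<in> borel_measurable borel" for n
    using borel_measurable_times[OF borel_measurable_continuous_onI, of "\<lambda>z. c n (f z)" "grad \<rho> f"]
      continuous_on_compose2[OF c(3) D(3)] by simp
  have "has_gradient \<rho> (\<lambda>_. 0) h"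
    unfolding has_gradient_iff
  proof (intro conjI allI)
    fix x
    have I: "set_integrable \<Lambda> (seg \<rho> x) (grad \<rho> f)" by (rule set_integrable_L2[OF D(2)])
    show "set_integrable \<Lambda> (seg \<rho> x) h"
      by (rule set_integrable_bound[OF I])
        (auto simp: h_def set_borel_measurable_def split: split_indicator)
    have "(\<lambda>n. LINT z:seg \<rho> x|\<Lambda>. c n (f z) * grad \<rho> f z) \<longlonglongrightarrow> (LINT z:seg \<rho> x|\<Lambda>. h z)"
      unfolding set_lebesgue_integral_def
    proof (rule integral_dominated_convergence)
      show "integrable \<Lambda> (\<lambda>z. \<bar>indicator (seg \<rho> x) z *\<^sub>R grad \<rho> f z\<bar>)"
        using I unfolding set_integrable_def by (rule integrable_abs)
      show "AE z in \<Lambda>. (\<lambda>n. indicator (seg \<rho> x) z *\<^sub>R (c n (f z) * grad \<rho> f z))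
          \<longlonglongrightarrow> indicator (seg \<rho> x) z *\<^sub>R h z"
      proof (intro AE_I2 tendsto_scaleR tendsto_const)
        fix z
        have "(\<lambda>n. c n (f z) * grad \<rho> f z) \<longlonglongrightarrow> (if f z = 0 then 1 else 0) * grad \<rho> f z"
          unfolding c_def by (intro tendsto_mult cutoff_tendsto tendsto_const)
        then show "(\<lambda>n. c n (f z) * grad \<rho> f z) \<longlonglongrightarrow> h z"
          by (simp add: h_def indicator_def of_bool_def)
      qed
      show "AE z in \<Lambda>. norm (indicator (seg \<rho> x) z *\<^sub>R (c n (f z) * grad \<rho> f z))
          \<le> \<bar>indicator (seg \<rho> x) z *\<^sub>R grad \<rho> f z\<bar>" for n
        using c(1,2)[of n] by (intro AE_I2) (auto simp: abs_mult mult_left_le_one_le split: split_indicator)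
      have "(\<lambda>z. indicator (seg \<rho> x) z *\<^sub>R (c n (f z) * grad \<rho> f z)) \<in> borel_measurable borel" for n
        using cm[of n] by (intro borel_measurable_scaleR) auto
      then show "(\<lambda>z. indicator (seg \<rho> x) z *\<^sub>R (c n (f z) * grad \<rho> f z)) \<in> borel_measurable \<Lambda>" for n
        by measurable
    qed measurable
    \<comment> \<open>The same integrals are increments of \<open>\<psi> n\<close> composed with
      \<open>f\<close>, and these tend to 0 because \<open>\<psi> n\<close> is uniformly
      small.\<close>
    moreover have "(LINT z:seg \<rho> x|\<Lambda>. c n (f z) * grad \<rho> f z) = \<psi> n (f x) - \<psi> n (f \<rho>)" for n
    proof -
      have "has_gradient \<rho> (\<lambda>x. \<psi> n (f x)) (\<lambda>x. c n (f x) * grad \<rho> f x)"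
        by (rule has_gradient_chain[OF D(1,3) \<psi>(1) c(3)])
      then have "\<psi> n (f x) = \<psi> n (f \<rho>) + (LINT z:seg \<rho> x|\<Lambda>. c n (f z) * grad \<rho> f z)"
        unfolding has_gradient_iff by blast
      then show ?thesis by simp
    qed
    moreover have "(\<lambda>n. \<psi> n (f x) - \<psi> n (f \<rho>)) \<longlonglongrightarrow> 0 - 0"
      by (intro tendsto_diff \<psi>0)
    ultimately show "0 = 0 + (LINT z:seg \<rho> x|\<Lambda>. h z)"
      by (simp add: LIMSEQ_unique)
  qed (rule h)
  then have "AE z in \<Lambda>. h z = 0"
    by (rule has_gradient_unique[OF _ has_gradient_const])
  then show ?thesis
    by (rule eventually_mono) (auto simp: h_def)
qed

lemma form_domain_dense:
  assumes \<nu>: "radon_measure \<nu>"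
  shows "dense_for (form1_dist \<rho> \<nu>) (form_domain \<rho> \<nu> \<inter> C_0) (form_domain \<rho> \<nu>)"
  unfolding dense_for_def
proof (intro conjI ballI allI impI)
  fix f and \<epsilon> :: real assume f: "f \<in> form_domain \<rho> \<nu>" and \<epsilon>: "\<epsilon> > 0"
  have fs: "f \<in> form_space \<rho>" and f\<nu>: "f \<in> L2 \<nu>" and finf: "f \<in> C_inf"
    using f by (auto simp: form_domain_def)
  note D = form_spaceD[OF fs]
  have sets: "sets \<nu> = sets borel" using \<nu> by (simp add: radon_measure_def)
  define e where "e n = 1 / real (Suc n)" for n
  have e: "e n > 0" for n by (simp add: e_def)
  define c where "c n = cutoff (e n)" for n
  have c: "0 \<le> c n t" "c n t \<le> 1" "continuous_on UNIV (c n)" for n t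
    using cutoff_props[OF e] by (auto simp: c_def)
  have "\<forall>n. \<exists>\<psi>. (\<forall>u. (\<psi> has_real_derivative c n u) (at u)) \<and> (\<forall>t. \<bar>t\<bar> \<le> e n \<longrightarrow> \<psi> t = t) \<and>
      (\<forall>t. \<bar>\<psi> t\<bar> \<le> \<bar>t\<bar> \<and> \<bar>\<psi> t\<bar> \<le> 2 * e n)"
    unfolding c_def using truncation_exists[OF e] by blast
  then obtain \<psi> where "\<forall>n. (\<forall>u. (\<psi> n has_real_derivative c n u) (at u)) \<and> (\<forall>t. \<bar>t\<bar> \<le> e n \<longrightarrow> \<psi> n t = t) \<and>
      (\<forall>t. \<bar>\<psi> n t\<bar> \<le> \<bar>t\<bar> \<and> \<bar>\<psi> n t\<bar> \<le> 2 * e n)"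
    by (rule choice[THEN exE])
  then have \<psi>: "\<And>n u. (\<psi> n has_real_derivative c n u) (at u)" "\<And>n t. \<bar>t\<bar> \<le> e n \<Longrightarrow> \<psi> n t = t"
      "\<And>n t. \<bar>\<psi> n t\<bar> \<le> \<bar>t\<bar>" "\<And>n t. \<bar>\<psi> n t\<bar> \<le> 2 * e n"
    by blast+
  have lim: "(\<lambda>n. 2 * e n) \<longlonglongrightarrow> 2 * 0"
    unfolding e_def by (intro tendsto_mult tendsto_const LIMSEQ_Suc[OF lim_1_over_n])
  have \<psi>0: "(\<lambda>n. \<psi> n t) \<longlonglongrightarrow> 0" for t
  proof (rule Lim_null_comparison)
    show "\<forall>\<^sub>F n in sequentially. norm (\<psi> n t) \<le> 2 * e n"
      using \<psi>(4) by (simp only: real_norm_def eventually_True)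
  qed (use lim in simp)
  define F where "F n x = f x - \<psi> n (f x)" for n x
  have F: "F n \<in> form_domain \<rho> \<nu> \<inter> C_0" for n
  proof -
    have "F n \<in> form_space \<rho>"
      unfolding F_def
    proof (rule form_space_chain(1)[OF fs, where \<phi> = "\<lambda>u. u - \<psi> n u" and \<phi>' = "\<lambda>u. 1 - c n u" and B = 1])
      show "((\<lambda>u. u - \<psi> n u) has_real_derivative 1 - c n u) (at u)" for u
        by (intro derivative_intros \<psi>)
      show "continuous_on UNIV (\<lambda>u. 1 - c n u)"
        by (intro continuous_intros c)
      show "\<bar>1 - c n (f x)\<bar> \<le> 1" for x
        using c(1,2)[of n "f x"] by simp
    qed
    moreover have "F n \<in> C_0"
    proof -
      obtain K where K: "compact K" "\<And>x. x \<notin> K \<Longrightarrow> \<bar>f x\<bar> \<le> e n"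
        using finf e[of n] by (auto simp: C_inf_def)
      \<comment> \<open>Off \<open>K\<close> the value of \<open>f\<close> lies where
        \<open>\<psi> n\<close> is the identity, so the difference is 0.\<close>
      have "{x. F n x \<noteq> 0} \<subseteq> K"
        using K(2) \<psi>(2) by (force simp: F_def)
      then have "closure {x. F n x \<noteq> 0} \<subseteq> K"
        using compact_imp_closed[OF K(1)] by (rule closure_minimal)
      then have "compact (closure {x. F n x \<noteq> 0})"
        using compact_Int_closed[OF K(1), of "closure {x. F n x \<noteq> 0}"] by (simp add: Int_absorb1)
      then show ?thesis
        using form_spaceD(3)[OF \<open>F n \<in> form_space \<rho>\<close>] by (simp add: C_0_def)
    qed
    ultimately show ?thesis using form_domain_C_0[OF \<nu>] by blast
  qed
  have [measurable]: "f \<in> borel_measurable borel" "grad \<rho> f \<in> borel_measurable borel"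
    using D by (auto intro: borel_measurable_continuous_onI simp: has_gradient_def)
  have cont\<psi>: "continuous_on UNIV (\<psi> n)" for n
    using \<psi>(1) by (meson DERIV_isCont continuous_at_imp_continuous_on)
  have [measurable]: "\<psi> n \<in> borel_measurable borel" "c n \<in> borel_measurable borel" for n
    using cont\<psi> c(3) by (auto intro: borel_measurable_continuous_onI)
  \<comment> \<open>The chosen gradient of the composition is known only almost everywhere, which
    suffices under the integral.\<close>
  have form: "form \<rho> (\<lambda>x. \<psi> n (f x)) (\<lambda>x. \<psi> n (f x)) = 1 / 2 * (\<integral>z. (c n (f z) * grad \<rho> f z)\<^sup>2 \<partial>\<Lambda>)" for n
  proof -
    have B: "\<bar>c n (f x)\<bar> \<le> 1" for x using c(1,2)[of n] by simp
    note chain = form_space_chain[OF fs \<psi>(1) c(3) B]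
    have "grad \<rho> (\<lambda>x. \<psi> n (f x)) \<in> borel_measurable borel"
      using form_spaceD(1)[OF chain(1)] by (simp add: has_gradient_def)
    then have [measurable]: "grad \<rho> (\<lambda>x. \<psi> n (f x)) \<in> borel_measurable \<Lambda>" by measurable
    show ?thesis
      unfolding form_def power2_eq_square
      by (intro arg_cong[where f = "\<lambda>u. 1 / 2 * u"] integral_cong_AE eventually_mono[OF chain(2)]) auto
  qed
  have lim1: "(\<lambda>n. \<integral>z. (c n (f z) * grad \<rho> f z)\<^sup>2 \<partial>\<Lambda>) \<longlonglongrightarrow> (\<integral>z. 0 \<partial>\<Lambda>)"
  proof (rule integral_dominated_convergence)
    show "integrable \<Lambda> (\<lambda>z. (grad \<rho> f z)\<^sup>2)" using D(2) by (simp add: L2_def)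
    show "AE z in \<Lambda>. (\<lambda>n. (c n (f z) * grad \<rho> f z)\<^sup>2) \<longlonglongrightarrow> 0"
      using grad_zero_set[OF fs]
    proof eventually_elim
      case (elim z)
      have "(\<lambda>n. (c n (f z) * grad \<rho> f z)\<^sup>2) \<longlonglongrightarrow> ((if f z = 0 then 1 else 0) * grad \<rho> f z)\<^sup>2"
        unfolding c_def e_def by (intro tendsto_power tendsto_mult cutoff_tendsto tendsto_const)
      then show ?case using elim by (auto split: if_splits)
    qed
    show "AE z in \<Lambda>. norm ((c n (f z) * grad \<rho> f z)\<^sup>2) \<le> (grad \<rho> f z)\<^sup>2" for n
    proof (rule AE_I2)
      fix z
      have "(c n (f z))\<^sup>2 \<le> 1" using c(1,2)[of n "f z"] by (simp add: power_le_one)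
      then show "norm ((c n (f z) * grad \<rho> f z)\<^sup>2) \<le> (grad \<rho> f z)\<^sup>2"
        by (simp add: power_mult_distrib mult_left_le_one_le)
    qed
  qed auto
  have lim2: "(\<lambda>n. \<integral>x. (\<psi> n (f x))\<^sup>2 \<partial>\<nu>) \<longlonglongrightarrow> (\<integral>x. 0 \<partial>\<nu>)"
  proof (rule integral_dominated_convergence)
    show "integrable \<nu> (\<lambda>x. (f x)\<^sup>2)" using f\<nu> by (simp add: L2_def)
    show "AE x in \<nu>. (\<lambda>n. (\<psi> n (f x))\<^sup>2) \<longlonglongrightarrow> 0"
      using tendsto_power[OF \<psi>0, of _ 2] by (intro AE_I2) simp
    show "AE x in \<nu>. norm ((\<psi> n (f x))\<^sup>2) \<le> (f x)\<^sup>2" for n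
      using \<psi>(3)[of n] by (intro AE_I2) (simp add: abs_le_square_iff)
    have "(\<lambda>x. (\<psi> n (f x))\<^sup>2) \<in> borel_measurable borel" for n by measurable
    then show "(\<lambda>x. (\<psi> n (f x))\<^sup>2) \<in> borel_measurable \<nu>" for n
      unfolding measurable_cong_sets[OF sets refl] .
  qed simp
  have "(\<lambda>n. form1_dist \<rho> \<nu> f (F n)) \<longlonglongrightarrow> sqrt (1 / 2 * (\<integral>z. 0 \<partial>\<Lambda>) + (\<integral>x. 0 \<partial>\<nu>))"
    unfolding form1_dist_def form1_def F_def diff_diff_eq2 add_diff_cancel_left' form
    by (simp only: diff_add_cancel add_diff_cancel power2_eq_square[symmetric] form)
      (intro tendsto_real_sqrt tendsto_add tendsto_mult tendsto_const lim1 lim2)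
  then have "(\<lambda>n. form1_dist \<rho> \<nu> f (F n)) \<longlonglongrightarrow> 0" by simp
  then have "\<forall>\<^sub>F n in sequentially. form1_dist \<rho> \<nu> f (F n) < \<epsilon>"
    using \<epsilon> by (rule order_tendstoD(2))
  then obtain n where "form1_dist \<rho> \<nu> f (F n) < \<epsilon>"
    by (auto simp: eventually_sequentially)
  then show "\<exists>g\<in>form_domain \<rho> \<nu> \<inter> C_0. form1_dist \<rho> \<nu> f g < \<epsilon>"
    using F by blast
qed simp

end

section \<open>Uniform approximation by functions of the form space\<close>

lemma C_0_add:
  assumes f: "f \<in> C_0" and g: "g \<in> C_0"
  shows "(\<lambda>x. f x + g x) \<in> C_0"
proof -
  have "{x. f x + g x \<noteq> 0} \<subseteq> {x. f x \<noteq> 0} \<union> {x. g x \<noteq> 0}" by auto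
  then have sub: "closure {x. f x + g x \<noteq> 0} \<subseteq> closure {x. f x \<noteq> 0} \<union> closure {x. g x \<noteq> 0}"
    by (metis closure_mono closure_Un)
  have "compact (closure {x. f x \<noteq> 0} \<union> closure {x. g x \<noteq> 0})"
    using f g by (intro compact_Un) (simp_all add: C_0_def)
  from compact_Int_closed[OF this closed_closure] sub
  have "compact (closure {x. f x + g x \<noteq> 0})" by (metis Int_absorb1)
  moreover have "continuous_on UNIV (\<lambda>x. f x + g x)"
    using f g by (intro continuous_on_add) (simp_all add: C_0_def)
  ultimately show ?thesis by (simp add: C_0_def)
qed

lemma C_0_sum: "finite D \<Longrightarrow> (\<And>x. x \<in> D \<Longrightarrow> b x \<in> C_0) \<Longrightarrow> (\<lambda>z. \<Sum>x\<in>D. b x z) \<in> C_0"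
proof (induction D rule: finite_induct)
  case (insert x D)
  then show ?case by (simp add: C_0_add)
qed (simp add: C_0_def)

context separable_tree
begin

text \<open>Boundedness is imposed to make this an algebra.\<close>

definition bounded_form_space :: "('a \<Rightarrow> real) set" where
  "bounded_form_space = {f \<in> form_space \<rho>. \<exists>B. \<forall>x. \<bar>f x\<bar> \<le> B}"

lemma bounded_form_space_const: "(\<lambda>_. c) \<in> bounded_form_space"
  by (auto simp: bounded_form_space_def form_space_const)

lemma bounded_form_space_add:
  assumes "f \<in> bounded_form_space" "g \<in> bounded_form_space"
  shows "(\<lambda>x. f x + g x) \<in> bounded_form_space"
proof -
  obtain A B where "\<And>x. \<bar>f x\<bar> \<le> A" "\<And>x. \<bar>g x\<bar> \<le> B"
    using assms by (auto simp: bounded_form_space_def)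
  then have "\<forall>x. \<bar>f x + g x\<bar> \<le> A + B"
    by (metis abs_triangle_ineq add_mono order_trans)
  then show ?thesis
    using assms form_space_add unfolding bounded_form_space_def by blast
qed

lemma bounded_form_space_mult:
  assumes "f \<in> bounded_form_space" "g \<in> bounded_form_space"
  shows "(\<lambda>x. f x * g x) \<in> bounded_form_space"
proof -
  obtain A B where AB: "\<And>x. \<bar>f x\<bar> \<le> A" "\<And>x. \<bar>g x\<bar> \<le> B"
    using assms by (auto simp: bounded_form_space_def)
  have "\<bar>f x * g x\<bar> \<le> A * B" for x
    using AB(1)[of x] AB(2)[of x] by (simp add: abs_mult mult_mono')
  then show ?thesis
    using assms form_space_mult[of f A g B] AB unfolding bounded_form_space_def by blast
qed

lemma bounded_form_space_sum:
  "finite D \<Longrightarrow> (\<And>x. x \<in> D \<Longrightarrow> b x \<in> bounded_form_space) \<Longrightarrow>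
    (\<lambda>z. \<Sum>x\<in>D. b x z) \<in> bounded_form_space"
proof (induction D rule: finite_induct)
  case (insert x D)
  then show ?case by (simp add: bounded_form_space_add)
qed (simp add: bounded_form_space_const)

lemma bounded_form_space_prod:
  "finite D \<Longrightarrow> (\<And>x. x \<in> D \<Longrightarrow> b x \<in> bounded_form_space) \<Longrightarrow>
    (\<lambda>z. \<Prod>x\<in>D. b x z) \<in> bounded_form_space"
proof (induction D rule: finite_induct)
  case (insert x D)
  then show ?case by (simp add: bounded_form_space_mult)
qed (simp add: bounded_form_space_const)

lemma bounded_form_space_gromov_root: "gromov \<rho> y \<in> bounded_form_space"
  using form_space_gromov gromov_bounds unfolding bounded_form_space_def by (auto intro!: exI[of _ "dist \<rho> y"])

text \<open>Gradients refer to the root, whereas the bumps are centered at \<open>x\<close>. A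
  change of base point expresses the product at \<open>x\<close> through two products at the root;
  the affine form is that of a factor of a bump.\<close>

lemma bounded_form_space_gromov: "(\<lambda>z. c + d * gromov x y z) \<in> bounded_form_space"
proof -
  \<comment> \<open>This is \<open>gromov x y \<rho>\<close>, the value at the root, where both
    products based at the root vanish.\<close>
  define k where "k = (dist x y + dist \<rho> x - dist \<rho> y) / 2"
  have "(\<lambda>z. c + d * (k + (gromov \<rho> y z + (-1) * gromov \<rho> x z))) \<in> bounded_form_space"
    by (intro bounded_form_space_add bounded_form_space_mult bounded_form_space_const
        bounded_form_space_gromov_root)
  also have "(\<lambda>z. c + d * (k + (gromov \<rho> y z + (-1) * gromov \<rho> x z))) = (\<lambda>z. c + d * gromov x y z)"
    by (intro ext) (simp add: gromov_def k_def field_simps)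
  finally show ?thesis .
qed

text \<open>Distinct points at distance \<open>R / 2\<close> from \<open>x\<close> extend to points at distance \<open>R\<close> from \<open>x\<close>
  that are at least \<open>R\<close> apart.\<close>

lemma finite_branches:
  assumes R: "R > 0" and K: "compact (cball x R)"
  shows "finite {y::'a. dist x y = R / 2 \<and> (\<exists>z. dist x z = R \<and> y \<in> seg x z)}" (is "finite ?Y")
proof -
  have "\<forall>y\<in>?Y. \<exists>z. dist x z = R \<and> y \<in> seg x z" by blast
  from bchoice[OF this] obtain z where "\<forall>y\<in>?Y. dist x (z y) = R \<and> y \<in> seg x (z y)" ..
  then have z: "dist x (z y) = R \<and> y \<in> seg x (z y)" if "y \<in> ?Y" for y
    using that by (rule bspec)
  have far: "y = y'" if y: "y \<in> ?Y" "y' \<in> ?Y" and close: "dist (z y) (z y') < R" for y y'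
  proof -
    \<comment> \<open>Two ends at distance less than \<open>R\<close> have Gromov product above
      \<open>R / 2\<close>, so their arcs still coincide at distance \<open>R / 2\<close>.\<close>
    have "dist x y \<le> gromov x (z y) (z y')"
      using z[OF y(1)] z[OF y(2)] y(1) close by (simp add: gromov_def)
    then have "y \<in> seg x (z y')"
      using seg_Int_iff z[OF y(1)] by blast
    moreover have "y' \<in> seg x (z y')" "dist x y = dist x y'"
      using z[OF y(2)] y by simp_all
    ultimately show ?thesis
      using geo_dist_seg by metis
  qed
  \<comment> \<open>A ball of radius \<open>R / 2\<close> has room for only one of the ends, so the
    centers of a finite cover count the branches.\<close>
  obtain F where F: "finite F" "cball x R \<subseteq> (\<Union>p\<in>F. ball p (R / 2))"
    using K R unfolding compact_eq_totally_bounded by (meson half_gt_zero)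
  have "\<forall>y\<in>?Y. \<exists>p. p \<in> F \<and> dist p (z y) < R / 2"
  proof
    fix y assume "y \<in> ?Y"
    then have "z y \<in> cball x R" using z by simp
    then have "z y \<in> (\<Union>p\<in>F. ball p (R / 2))" using F(2) by blast
    then show "\<exists>p. p \<in> F \<and> dist p (z y) < R / 2" by auto
  qed
  from bchoice[OF this] obtain p where "\<forall>y\<in>?Y. p y \<in> F \<and> dist (p y) (z y) < R / 2" ..
  then have p: "p y \<in> F \<and> dist (p y) (z y) < R / 2" if "y \<in> ?Y" for y
    using that by (rule bspec)
  have "inj_on p ?Y"
  proof (rule inj_onI)
    fix y y' assume y: "y \<in> ?Y" "y' \<in> ?Y" "p y = p y'"
    have "dist (z y) (z y') \<le> dist (p y) (z y) + dist (p y) (z y')"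
      by (metis dist_commute dist_triangle)
    also have "\<dots> < R"
      using p[OF y(1)] p[OF y(2)] y(3) by simp
    finally show "y = y'" by (rule far[OF y(1,2)])
  qed
  moreover have "p ` ?Y \<subseteq> F" using p by blast
  ultimately show ?thesis using F(1) by (rule inj_on_finite)
qed

text \<open>The bump only sees the finitely many arcs from \<open>x\<close> to the points at distance \<open>R / 2\<close>
  through which the tree leaves the ball, so its gradient is square integrable although the
  ball itself may have infinite length.\<close>

lemma bump_exists:
  assumes R: "R > 0" and K: "compact (cball x R)"
  shows "\<exists>b\<in>bounded_form_space \<inter> C_0. (\<forall>z. 0 \<le> b z) \<and> b x > 0"
proof -
  define Y where "Y = {y::'a. dist x y = R / 2 \<and> (\<exists>z. dist x z = R \<and> y \<in> seg x z)}"
  have Y: "finite Y" unfolding Y_def by (rule finite_branches[OF R K])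
  \<comment> \<open>Each factor falls from \<open>R / 2\<close> at \<open>x\<close> to 0 at
    \<open>y\<close>. An empty product is 1, which is harmless: then no point is at distance
    \<open>R\<close> or more.\<close>
  define b where "b z = (\<Prod>y\<in>Y. R / 2 + (-1) * gromov x y z)" for z
  have b: "b \<in> bounded_form_space"
    unfolding b_def using Y by (intro bounded_form_space_prod bounded_form_space_gromov)
  have "0 \<le> b z" for z
    unfolding b_def using gromov_bounds(2) by (intro prod_nonneg) (auto simp: Y_def)
  moreover have "b x > 0"
    unfolding b_def using R by (intro prod_pos) (auto simp: gromov_def dist_commute)
  \<comment> \<open>The arc from \<open>x\<close> to such a \<open>z\<close> leaves the ball through
    some \<open>y\<close> in \<open>Y\<close>, and the factor of this \<open>y\<close> is 0 from
    there on.\<close>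
  moreover have "b z = 0" if z: "R \<le> dist x z" for z
  proof -
    define w y where "w = geo x z R" and "y = geo x z (R / 2)"
    have w: "w \<in> seg x z" "dist x w = R" and y: "y \<in> seg x z" "dist x y = R / 2"
      using R z geo_in_seg[of R x z] geo_in_seg[of "R / 2" x z]
        dist_geo_left[of R x z] dist_geo_left[of "R / 2" x z] by (auto simp: w_def y_def)
    then have "y \<in> seg x w"
      using seg_left_iff[OF w(1), of y] R by simp
    then have "y \<in> Y" using w y by (auto simp: Y_def)
    moreover have "gromov x y z = R / 2"
      using y by (simp add: gromov_def seg_iff)
    ultimately show ?thesis
      unfolding b_def using Y by (intro prod_zero) auto
  qed
  then have "{z. b z \<noteq> 0} \<subseteq> cball x R"
    by (metis (mono_tags, lifting) mem_Collect_eq mem_cball nle_le subsetI)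
  then have "closure {z. b z \<noteq> 0} \<subseteq> cball x R"
    by (rule closure_minimal) simp
  then have "compact (closure {z. b z \<noteq> 0})"
    using compact_Int_closed[OF K closed_closure] by (metis Int_absorb1)
  then have "b \<in> C_0"
    using b form_spaceD(3) by (auto simp: C_0_def bounded_form_space_def)
  ultimately show ?thesis using b by blast
qed

lemma bounded_form_space_function_ring:
  assumes "compact S"
  shows "function_ring_on bounded_form_space S"
proof
  fix x y :: 'a assume "x \<noteq> y"
  \<comment> \<open>If neither function separates the points, then \<open>dist x y\<close> equals
    both differences of their distances to the root, and these have opposite signs.\<close>
  have "gromov \<rho> y x \<noteq> gromov \<rho> y y \<or> gromov \<rho> x x \<noteq> gromov \<rho> x y"
  proof (rule ccontr)
    assume "\<not> ?thesis"
    then have "gromov \<rho> y x = dist \<rho> y" "dist \<rho> x = gromov \<rho> x y"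
      by (simp_all add: gromov_def)
    then have "2 * dist x y \<le> 0"
      unfolding gromov_def dist_commute[of y x] by argo
    then show False using \<open>x \<noteq> y\<close> by simp
  qed
  then show "\<exists>f\<in>bounded_form_space. f x \<noteq> f y"
    using bounded_form_space_gromov_root by blast
next
  fix f assume "f \<in> bounded_form_space"
  then show "continuous_on S f"
    using form_spaceD(3) continuous_on_subset[of UNIV f S] by (auto simp: bounded_form_space_def)
qed (use assms bounded_form_space_add bounded_form_space_mult bounded_form_space_const in auto)

lemma C_0_dense:
  assumes lc: "locally compact (UNIV :: 'a set)" and \<nu>: "radon_measure \<nu>"
  shows "dense_for sup_dist (form_domain \<rho> \<nu> \<inter> C_0) C_0"
  unfolding dense_for_def
proof (intro conjI ballI allI impI)
  fix f :: "'a \<Rightarrow> real" and \<epsilon> :: real assume f: "f \<in> C_0" and \<epsilon>: "\<epsilon> > 0"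
  define K where "K = closure {x. f x \<noteq> 0}"
  have K: "compact K" and contf: "continuous_on UNIV f" using f by (auto simp: C_0_def K_def)
  have f0: "f x = 0" if "x \<notin> K" for x
    using that closure_subset[of "{x. f x \<noteq> 0}"] by (auto simp: K_def)
  have "\<forall>x. \<exists>b. b \<in> bounded_form_space \<and> b \<in> C_0 \<and> (\<forall>z. 0 \<le> b z) \<and> b x > 0"
  proof
    fix x :: 'a
    obtain R where "R > 0" "compact (cball x R)"
      using locally_compact_cball[OF lc, of x] by blast
    from bump_exists[OF this] show "\<exists>b. b \<in> bounded_form_space \<and> b \<in> C_0 \<and> (\<forall>z. 0 \<le> b z) \<and> b x > 0"
      by blast
  qed
  then obtain b where b: "\<And>x. b x \<in> bounded_form_space" "\<And>x. b x \<in> C_0" "\<And>x z. 0 \<le> b x z" "\<And>x. b x x > 0"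
    by metis
  obtain D where D: "finite D" "K \<subseteq> (\<Union>x\<in>D. {z. 0 < b x z})"
  proof (rule compactE_image[OF K, of K "\<lambda>x. {z. 0 < b x z}"])
    show "open {z. 0 < b x z}" for x
      using b(2)[of x] by (intro open_Collect_less continuous_on_const) (simp add: C_0_def)
    show "K \<subseteq> (\<Union>x\<in>K. {z. 0 < b x z})" using b(4) by blast
  qed blast
  define B where "B z = (\<Sum>x\<in>D. b x z)" for z
  have B: "B \<in> bounded_form_space" "B \<in> C_0"
    unfolding B_def using D(1) b(1,2) by (intro bounded_form_space_sum C_0_sum; simp)+
  have Bnn: "B z \<ge> 0" for z unfolding B_def using b(3) by (intro sum_nonneg)
  have Bpos: "B z > 0" if z: "z \<in> K" for z
  proof -
    obtain x where "x \<in> D" "0 < b x z" using D(2) z by blast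
    then show ?thesis unfolding B_def using D(1) b(3) by (intro sum_pos2[of D x]) auto
  qed
  have contB: "continuous_on UNIV B" using B(2) by (simp add: C_0_def)
  obtain m where m: "m > 0" "\<And>z. z \<in> K \<Longrightarrow> m \<le> B z"
  proof (cases "K = {}")
    case False
    then obtain z0 where "z0 \<in> K" "\<And>z. z \<in> K \<Longrightarrow> B z0 \<le> B z"
      using continuous_attains_inf[OF K False continuous_on_subset[OF contB subset_UNIV]] by blast
    then show ?thesis using Bpos that[of "B z0"] by blast
  qed (use that[of 1] in auto)
  obtain M where M: "M > 0" "\<And>z. \<bar>B z\<bar> \<le> M"
  proof -
    obtain M' where "\<And>z. \<bar>B z\<bar> \<le> M'" using C_0_bounded[OF B(2)] by blast
    then show ?thesis using that[of "max 1 M'"] by (simp add: le_max_iff_disj)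
  qed
  \<comment> \<open>The lower bound \<open>m\<close> keeps \<open>h\<close> continuous everywhere.
    It changes nothing on \<open>K\<close>, where \<open>B\<close> is at least \<open>m\<close>, and
    off \<open>K\<close> the numerator is 0.\<close>
  define h where "h x = f x / max (B x) m" for x
  have fh: "f x = h x * B x" for x
  proof (cases "x \<in> K")
    case True
    then show ?thesis using m(1) m(2)[OF True] by (simp add: h_def max_absorb1)
  qed (simp add: h_def f0)
  \<comment> \<open>Off \<open>S\<close> both \<open>f\<close> and the approximant vanish, so
    \<open>h\<close> has to be approximated on \<open>S\<close> only.\<close>
  define S where "S = closure {z. B z \<noteq> 0}"
  have S: "compact S" using B(2) by (simp add: S_def C_0_def)
  have "max (B x) m \<noteq> 0" for x using m(1) by (simp add: max_def)
  then have "continuous_on UNIV h"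
    unfolding h_def by (intro continuous_on_divide continuous_on_max contf contB continuous_on_const) auto
  then have "continuous_on S h" by (rule continuous_on_subset) simp
  then obtain a where a: "a \<in> bounded_form_space" "\<And>x. x \<in> S \<Longrightarrow> \<bar>h x - a x\<bar> < \<epsilon> / (2 * M)"
    using function_ring_on.Stone_Weierstrass_basic[OF bounded_form_space_function_ring[OF S], of h "\<epsilon> / (2 * M)"] \<epsilon> M(1)
    by auto
  define g where "g x = a x * B x" for x
  have "g \<in> bounded_form_space"
    unfolding g_def by (intro bounded_form_space_mult a B)
  moreover have "g \<in> C_0"
    unfolding g_def using a(1) B(2) form_spaceD(3) by (intro C_0_mult) (auto simp: bounded_form_space_def)
  ultimately have "g \<in> form_domain \<rho> \<nu> \<inter> C_0"
    using form_domain_C_0[OF \<nu>] by (auto simp: bounded_form_space_def)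
  \<comment> \<open>Half of \<open>\<epsilon>\<close> is used because the supremum can attain the
    bound, while the conclusion is strict.\<close>
  moreover have "\<bar>f x - g x\<bar> \<le> \<epsilon> / 2" for x
  proof (cases "B x = 0")
    case True
    then show ?thesis using fh[of x] \<epsilon> by (simp add: g_def)
  next
    case False
    then have "x \<in> S" using closure_subset[of "{z. B z \<noteq> 0}"] by (auto simp: S_def)
    have "\<bar>f x - g x\<bar> = \<bar>h x - a x\<bar> * \<bar>B x\<bar>"
      using fh[of x] by (simp add: g_def left_diff_distrib[symmetric] abs_mult)
    also have "\<dots> \<le> \<epsilon> / (2 * M) * M"
      using a(2)[OF \<open>x \<in> S\<close>] M(2)[of x] M(1) by (intro mult_mono) auto
    also have "\<dots> = \<epsilon> / 2" using M(1) by simp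
    finally show ?thesis .
  qed
  then have "sup_dist f g \<le> \<epsilon> / 2"
    unfolding sup_dist_def by (intro cSUP_least) auto
  then have "sup_dist f g < \<epsilon>" using \<epsilon> by linarith
  ultimately show "\<exists>g\<in>form_domain \<rho> \<nu> \<inter> C_0. sup_dist f g < \<epsilon>" by blast
qed simp

end

theorem proposition4p1:
  fixes \<rho> :: "'a::metric_space" and \<nu> :: "'a measure"
  assumes "R_tree TYPE('a)"
    and "locally compact (UNIV :: 'a set)"
    and "radon_measure \<nu>"
  shows "dense_for (form1_dist \<rho> \<nu>) (form_domain \<rho> \<nu> \<inter> C_0) (form_domain \<rho> \<nu>)
       \<and> dense_for sup_dist (form_domain \<rho> \<nu> \<inter> C_0) C_0"
proof -
  interpret real_tree "TYPE('a)"
    using assms(1) by unfold_locales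
  obtain X :: "nat \<Rightarrow> 'a" where "\<forall>x. \<forall>e>0. \<exists>n. dist (X n) x < e"
    using connected_locally_compact_separable[OF connected_tree assms(2)] by blast
  then interpret separable_tree "TYPE('a)" \<rho> X
    by unfold_locales blast
  show ?thesis
    using form_domain_dense[OF assms(3)] C_0_dense[OF assms(2,3)] ..
qed

end
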